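(* Let $\mathcal{A}$ be a regular category. The following conditions are equivalent: (i) $\mathcal{A}$ is an exact arithmetical category; (ii) $\mathcal{A}$ satisfies $(\mathrm{CRT}_2)$ and $(\mathrm{CRT}_3)$ for regular epimorphisms; (iii) $\mathcal{A}$ satisfies $(\mathrm{CRT}_n)$ for regular epimorphisms, for every $n\ge 2$.
   Context: All categories are assumed finitely complete. A category is regular if kernel pairs admit coequalizers and regular epimorphisms are stable under pullback. It is (Barr-)exact if it is regular and every internal equivalence relation is effective, i.e. is the kernel pair of some morphism. A Mal'tsev category is a finitely complete category in which every internal reflexive relation $R\rightarrowtail X\times X$ is an equivalence relation. For an object $X$, $\mathrm{Equiv}(X)$ denotes the poset of internal equivalence relations on $X$, ordered by inclusion of subobjects of $X\times X$; in an exact Mal'tsev category it is a lattice (meets are intersections, and the join of $\theta$ and $\varphi$ is the relational composite $\theta\circ\varphi=\varphi\circ\theta$). An (exact) arithmetical category is an exact Mal'tsev category such that the lattice $\mathrm{Equiv}(X)$ is distributive for every object $X$. For $n\ge 2$, a regular category $\mathcal{A}$ satisfies $(\mathrm{CRT}_n)$ for regular epimorphisms if, for every family of $n$ regular epimorphisms $r_i\colon X\to B_i$ ($1\le i\le n$) with common domain, the pairwise pushouts $B_i\to D_{ij}\leftarrow B_j$ of $(r_i,r_j)$ exist for all $1\le i<j\le n$, and the canonical comparison morphism, induced by the cone $(r_i)_i$, from $X$ to the limit of the diagram formed by the objects $B_i$, $D_{ij}$ and the pushout coprojections $B_i\to D_{ij}\leftarrow B_j$ ($i<j$) is a regular epimorphism.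 *)

theory Defs
  imports "HOL-Algebra.Lattice"
begin

section \<open>Categories\<close>

record ('o, 'm) cat =
  Obj   :: "'o set"
  Mor   :: "'m set"
  Dom   :: "'m \<Rightarrow> 'o"
  Cod   :: "'m \<Rightarrow> 'o"
  Ident :: "'o \<Rightarrow> 'm"
  Comp  :: "'m \<Rightarrow> 'm \<Rightarrow> 'm"  (infixr \<open>\<cdot>\<index>\<close> 70)

text \<open>Composition is in applicative order: \<open>g \<cdot> f\<close> is \<open>f\<close> followed by \<open>g\<close>, and is
  meaningful only if \<open>Cod f = Dom g\<close>.\<close>

definition Hom :: "('o, 'm) cat \<Rightarrow> 'o \<Rightarrow> 'o \<Rightarrow> 'm set" where
  "Hom C X Y = {f \<in> Mor C. Dom C f = X \<and> Cod C f = Y}"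

locale category =
  fixes C :: "('o, 'm) cat" (structure)
  assumes Dom_closed: "f \<in> Mor C \<Longrightarrow> Dom C f \<in> Obj C"
    and Cod_closed: "f \<in> Mor C \<Longrightarrow> Cod C f \<in> Obj C"
    and Ident_closed: "X \<in> Obj C \<Longrightarrow> Ident C X \<in> Hom C X X"
    and Comp_closed: "\<lbrakk>f \<in> Hom C X Y; g \<in> Hom C Y Z\<rbrakk> \<Longrightarrow> g \<cdot> f \<in> Hom C X Z"
    and Comp_assoc: "\<lbrakk>f \<in> Hom C W X; g \<in> Hom C X Y; h \<in> Hom C Y Z\<rbrakk>
                      \<Longrightarrow> (h \<cdot> g) \<cdot> f = h \<cdot> (g \<cdot> f)"
    and Comp_Ident: "f \<in> Hom C X Y \<Longrightarrow> f \<cdot> Ident C X = f"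
    and Ident_Comp: "f \<in> Hom C X Y \<Longrightarrow> Ident C Y \<cdot> f = f"

definition monic :: "('o, 'm) cat \<Rightarrow> 'm \<Rightarrow> bool" where
  "monic C m \<longleftrightarrow> m \<in> Mor C \<and>
     (\<forall>Y. \<forall>f \<in> Hom C Y (Dom C m). \<forall>g \<in> Hom C Y (Dom C m).
        m \<cdot>\<^bsub>C\<^esub> f = m \<cdot>\<^bsub>C\<^esub> g \<longrightarrow> f = g)"


section \<open>Limits of diagrams\<close>

text \<open>The shape of a diagram is a directed graph.\<close>

record ('v, 'e, 'o, 'm) diagram =
  Nodes :: "'v set"
  Edges :: "'e set"
  Src   :: "'e \<Rightarrow> 'v"
  Tgt   :: "'e \<Rightarrow> 'v"
  ObAt  :: "'v \<Rightarrow> 'o"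
  MorAt :: "'e \<Rightarrow> 'm"

definition is_diagram :: "('o, 'm) cat \<Rightarrow> ('v, 'e, 'o, 'm) diagram \<Rightarrow> bool" where
  "is_diagram C G \<longleftrightarrow>
     (\<forall>v \<in> Nodes G. ObAt G v \<in> Obj C) \<and>
     (\<forall>e \<in> Edges G. Src G e \<in> Nodes G \<and> Tgt G e \<in> Nodes G \<and>
        MorAt G e \<in> Hom C (ObAt G (Src G e)) (ObAt G (Tgt G e)))"

definition is_cone ::
  "('o, 'm) cat \<Rightarrow> ('v, 'e, 'o, 'm) diagram \<Rightarrow> 'o \<Rightarrow> ('v \<Rightarrow> 'm) \<Rightarrow> bool" where
  "is_cone C G L p \<longleftrightarrow> L \<in> Obj C \<and>
     (\<forall>v \<in> Nodes G. p v \<in> Hom C L (ObAt G v)) \<and>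
     (\<forall>e \<in> Edges G. MorAt G e \<cdot>\<^bsub>C\<^esub> p (Src G e) = p (Tgt G e))"

definition is_cone_morphism ::
  "('o, 'm) cat \<Rightarrow> ('v, 'e, 'o, 'm) diagram \<Rightarrow> 'o \<Rightarrow> ('v \<Rightarrow> 'm) \<Rightarrow> 'o \<Rightarrow> ('v \<Rightarrow> 'm) \<Rightarrow> 'm \<Rightarrow> bool" where
  "is_cone_morphism C G Y q L p h \<longleftrightarrow>
     h \<in> Hom C Y L \<and> (\<forall>v \<in> Nodes G. p v \<cdot>\<^bsub>C\<^esub> h = q v)"

definition is_limit ::
  "('o, 'm) cat \<Rightarrow> ('v, 'e, 'o, 'm) diagram \<Rightarrow> 'o \<Rightarrow> ('v \<Rightarrow> 'm) \<Rightarrow> bool" where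
  "is_limit C G L p \<longleftrightarrow> is_cone C G L p \<and>
     (\<forall>Y q. is_cone C G Y q \<longrightarrow> (\<exists>!h. is_cone_morphism C G Y q L p h))"

definition comparison ::
  "('o, 'm) cat \<Rightarrow> ('v, 'e, 'o, 'm) diagram \<Rightarrow> 'o \<Rightarrow> ('v \<Rightarrow> 'm) \<Rightarrow> 'o \<Rightarrow> ('v \<Rightarrow> 'm) \<Rightarrow> 'm" where
  "comparison C G Y q L p = (THE h. is_cone_morphism C G Y q L p h)"

text \<open>Every finite graph is isomorphic to one whose nodes and edges are natural numbers.\<close>

definition finitely_complete :: "('o, 'm) cat \<Rightarrow> bool" where
  "finitely_complete C \<longleftrightarrow> category C \<and>
     (\<forall>G :: (nat, nat, 'o, 'm) diagram.
        is_diagram C G \<and> finite (Nodes G) \<and> finite (Edges G) \<longrightarrow> (\<exists>L p. is_limit C G L p))"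


section \<open>Products, pullbacks, pushouts and coequalizers\<close>

definition is_product :: "('o, 'm) cat \<Rightarrow> 'o \<Rightarrow> 'o \<Rightarrow> 'o \<Rightarrow> 'm \<Rightarrow> 'm \<Rightarrow> bool" where
  "is_product C X Y P p q \<longleftrightarrow> p \<in> Hom C P X \<and> q \<in> Hom C P Y \<and>
     (\<forall>Z. \<forall>f \<in> Hom C Z X. \<forall>g \<in> Hom C Z Y.
        \<exists>!h. h \<in> Hom C Z P \<and> p \<cdot>\<^bsub>C\<^esub> h = f \<and> q \<cdot>\<^bsub>C\<^esub> h = g)"

definition is_pullback :: "('o, 'm) cat \<Rightarrow> 'm \<Rightarrow> 'm \<Rightarrow> 'o \<Rightarrow> 'm \<Rightarrow> 'm \<Rightarrow> bool" where
  "is_pullback C f g P p q \<longleftrightarrow>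
     f \<in> Mor C \<and> g \<in> Mor C \<and> Cod C f = Cod C g \<and>
     p \<in> Hom C P (Dom C f) \<and> q \<in> Hom C P (Dom C g) \<and> f \<cdot>\<^bsub>C\<^esub> p = g \<cdot>\<^bsub>C\<^esub> q \<and>
     (\<forall>Z. \<forall>a \<in> Hom C Z (Dom C f). \<forall>b \<in> Hom C Z (Dom C g). f \<cdot>\<^bsub>C\<^esub> a = g \<cdot>\<^bsub>C\<^esub> b \<longrightarrow>
        (\<exists>!h. h \<in> Hom C Z P \<and> p \<cdot>\<^bsub>C\<^esub> h = a \<and> q \<cdot>\<^bsub>C\<^esub> h = b))"

definition is_pushout :: "('o, 'm) cat \<Rightarrow> 'm \<Rightarrow> 'm \<Rightarrow> 'o \<Rightarrow> 'm \<Rightarrow> 'm \<Rightarrow> bool" where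
  "is_pushout C f g D u v \<longleftrightarrow>
     f \<in> Mor C \<and> g \<in> Mor C \<and> Dom C f = Dom C g \<and>
     u \<in> Hom C (Cod C f) D \<and> v \<in> Hom C (Cod C g) D \<and> u \<cdot>\<^bsub>C\<^esub> f = v \<cdot>\<^bsub>C\<^esub> g \<and>
     (\<forall>Z. \<forall>a \<in> Hom C (Cod C f) Z. \<forall>b \<in> Hom C (Cod C g) Z. a \<cdot>\<^bsub>C\<^esub> f = b \<cdot>\<^bsub>C\<^esub> g \<longrightarrow>
        (\<exists>!h. h \<in> Hom C D Z \<and> h \<cdot>\<^bsub>C\<^esub> u = a \<and> h \<cdot>\<^bsub>C\<^esub> v = b))"

definition is_coequalizer :: "('o, 'm) cat \<Rightarrow> 'm \<Rightarrow> 'm \<Rightarrow> 'm \<Rightarrow> bool" where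
  "is_coequalizer C f g q \<longleftrightarrow>
     f \<in> Mor C \<and> g \<in> Mor C \<and> Dom C f = Dom C g \<and> Cod C f = Cod C g \<and>
     q \<in> Mor C \<and> Dom C q = Cod C f \<and> q \<cdot>\<^bsub>C\<^esub> f = q \<cdot>\<^bsub>C\<^esub> g \<and>
     (\<forall>Z. \<forall>t \<in> Hom C (Cod C f) Z. t \<cdot>\<^bsub>C\<^esub> f = t \<cdot>\<^bsub>C\<^esub> g \<longrightarrow>
        (\<exists>!h. h \<in> Hom C (Cod C q) Z \<and> h \<cdot>\<^bsub>C\<^esub> q = t))"

definition is_kernel_pair :: "('o, 'm) cat \<Rightarrow> 'm \<Rightarrow> 'o \<Rightarrow> 'm \<Rightarrow> 'm \<Rightarrow> bool" where
  "is_kernel_pair C f K k l \<longleftrightarrow> is_pullback C f f K k l"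

definition regular_epi :: "('o, 'm) cat \<Rightarrow> 'm \<Rightarrow> bool" where
  "regular_epi C q \<longleftrightarrow> (\<exists>f g. is_coequalizer C f g q)"

definition regular_category :: "('o, 'm) cat \<Rightarrow> bool" where
  "regular_category C \<longleftrightarrow> finitely_complete C \<and>
     (\<forall>f K k l. is_kernel_pair C f K k l \<longrightarrow> (\<exists>q. is_coequalizer C k l q)) \<and>
     (\<forall>f g P p q. regular_epi C f \<and> is_pullback C f g P p q \<longrightarrow> regular_epi C q)"


section \<open>Internal relations\<close>

text \<open>A chosen product \<open>X \<times> X\<close> with its projections; it exists if \<open>C\<close> is finitely complete.\<close>

definition square :: "('o, 'm) cat \<Rightarrow> 'o \<Rightarrow> 'o \<times> 'm \<times> 'm" where
  "square C X = (SOME (P, p, q). is_product C X X P p q)"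

definition square_obj :: "('o, 'm) cat \<Rightarrow> 'o \<Rightarrow> 'o" where
  "square_obj C X = fst (square C X)"

definition proj1 :: "('o, 'm) cat \<Rightarrow> 'o \<Rightarrow> 'm" where
  "proj1 C X = fst (snd (square C X))"

definition proj2 :: "('o, 'm) cat \<Rightarrow> 'o \<Rightarrow> 'm" where
  "proj2 C X = snd (snd (square C X))"

text \<open>A relation on \<open>X\<close> is represented by a monomorphism \<open>m\<close> from \<open>Dom C m\<close> to \<open>X \<times> X\<close>, with
  legs \<open>leg1 C X m\<close> and \<open>leg2 C X m\<close> from \<open>Dom C m\<close> to \<open>X\<close>.\<close>

definition is_relation :: "('o, 'm) cat \<Rightarrow> 'o \<Rightarrow> 'm \<Rightarrow> bool" where
  "is_relation C X m \<longleftrightarrow> monic C m \<and> Cod C m = square_obj C X"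

definition leg1 :: "('o, 'm) cat \<Rightarrow> 'o \<Rightarrow> 'm \<Rightarrow> 'm" where
  "leg1 C X m = proj1 C X \<cdot>\<^bsub>C\<^esub> m"

definition leg2 :: "('o, 'm) cat \<Rightarrow> 'o \<Rightarrow> 'm \<Rightarrow> 'm" where
  "leg2 C X m = proj2 C X \<cdot>\<^bsub>C\<^esub> m"

definition reflexive_relation :: "('o, 'm) cat \<Rightarrow> 'o \<Rightarrow> 'm \<Rightarrow> bool" where
  "reflexive_relation C X m \<longleftrightarrow> is_relation C X m \<and>
     (\<exists>e \<in> Hom C X (Dom C m).
        leg1 C X m \<cdot>\<^bsub>C\<^esub> e = Ident C X \<and> leg2 C X m \<cdot>\<^bsub>C\<^esub> e = Ident C X)"

definition symmetric_relation :: "('o, 'm) cat \<Rightarrow> 'o \<Rightarrow> 'm \<Rightarrow> bool" where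
  "symmetric_relation C X m \<longleftrightarrow> is_relation C X m \<and>
     (\<exists>s \<in> Hom C (Dom C m) (Dom C m).
        leg1 C X m \<cdot>\<^bsub>C\<^esub> s = leg2 C X m \<and> leg2 C X m \<cdot>\<^bsub>C\<^esub> s = leg1 C X m)"

text \<open>The pullback \<open>T\<close> is the object of pairs \<open>(x, y), (y, z)\<close> in the relation, and \<open>t\<close> sends such
  a pair to \<open>(x, z)\<close>.\<close>

definition transitive_relation :: "('o, 'm) cat \<Rightarrow> 'o \<Rightarrow> 'm \<Rightarrow> bool" where
  "transitive_relation C X m \<longleftrightarrow> is_relation C X m \<and>
     (\<forall>T a b. is_pullback C (leg2 C X m) (leg1 C X m) T a b \<longrightarrow>
        (\<exists>t \<in> Hom C T (Dom C m).
           leg1 C X m \<cdot>\<^bsub>C\<^esub> t = leg1 C X m \<cdot>\<^bsub>C\<^esub> a \<and>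
           leg2 C X m \<cdot>\<^bsub>C\<^esub> t = leg2 C X m \<cdot>\<^bsub>C\<^esub> b))"

definition equivalence_relation :: "('o, 'm) cat \<Rightarrow> 'o \<Rightarrow> 'm \<Rightarrow> bool" where
  "equivalence_relation C X m \<longleftrightarrow>
     reflexive_relation C X m \<and> symmetric_relation C X m \<and> transitive_relation C X m"

definition effective :: "('o, 'm) cat \<Rightarrow> 'o \<Rightarrow> 'm \<Rightarrow> bool" where
  "effective C X m \<longleftrightarrow> (\<exists>f. is_kernel_pair C f (Dom C m) (leg1 C X m) (leg2 C X m))"

definition exact_category :: "('o, 'm) cat \<Rightarrow> bool" where
  "exact_category C \<longleftrightarrow> regular_category C \<and>
     (\<forall>X \<in> Obj C. \<forall>m. equivalence_relation C X m \<longrightarrow> effective C X m)"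

definition maltsev_category :: "('o, 'm) cat \<Rightarrow> bool" where
  "maltsev_category C \<longleftrightarrow> finitely_complete C \<and>
     (\<forall>X \<in> Obj C. \<forall>m. reflexive_relation C X m \<longrightarrow> equivalence_relation C X m)"


section \<open>The lattice of equivalence relations\<close>

definition subobject_le :: "('o, 'm) cat \<Rightarrow> 'm \<Rightarrow> 'm \<Rightarrow> bool" where
  "subobject_le C m n \<longleftrightarrow> (\<exists>k \<in> Hom C (Dom C m) (Dom C n). m = n \<cdot>\<^bsub>C\<^esub> k)"

text \<open>Subobjects are monomorphisms up to mutual factorization.  Instead of forming equivalence
  classes, this identification is the equality \<open>eq\<close> of the ordered structure.\<close>

definition Equiv :: "('o, 'm) cat \<Rightarrow> 'o \<Rightarrow> 'm gorder" where
  "Equiv C X = \<lparr>carrier = {m. equivalence_relation C X m},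
                eq = (\<lambda>m n. subobject_le C m n \<and> subobject_le C n m),
                le = subobject_le C\<rparr>"

definition distributive_lattice :: "('a, 'b) gorder_scheme \<Rightarrow> bool" where
  "distributive_lattice L \<longleftrightarrow> weak_lattice L \<and>
     (\<forall>x \<in> carrier L. \<forall>y \<in> carrier L. \<forall>z \<in> carrier L.
        x \<sqinter>\<^bsub>L\<^esub> (y \<squnion>\<^bsub>L\<^esub> z) .=\<^bsub>L\<^esub> (x \<sqinter>\<^bsub>L\<^esub> y) \<squnion>\<^bsub>L\<^esub> (x \<sqinter>\<^bsub>L\<^esub> z))"

definition exact_arithmetical_category :: "('o, 'm) cat \<Rightarrow> bool" where
  "exact_arithmetical_category C \<longleftrightarrow> exact_category C \<and> maltsev_category C \<and>
     (\<forall>X \<in> Obj C. distributive_lattice (Equiv C X))"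


section \<open>The Chinese remainder condition\<close>

datatype crt_node = Quot nat | Push nat nat
datatype crt_edge = Left nat nat | Right nat nat

text \<open>For a family \<open>r i\<close> from \<open>X\<close> to \<open>B i\<close> and pushouts \<open>D i j\<close> of \<open>r i\<close> and \<open>r j\<close> with
  coprojections \<open>u i j\<close> from \<open>B i\<close> and \<open>v i j\<close> from \<open>B j\<close>: the node \<open>Quot i\<close> carries \<open>B i\<close>,
  \<open>Push i j\<close> carries \<open>D i j\<close>, and the edges \<open>Left i j\<close> and \<open>Right i j\<close> carry \<open>u i j\<close> and
  \<open>v i j\<close>.\<close>

definition crt_diagram ::
  "('o, 'm) cat \<Rightarrow> nat \<Rightarrow> (nat \<Rightarrow> 'm) \<Rightarrow> (nat \<Rightarrow> nat \<Rightarrow> 'o) \<Rightarrow> (nat \<Rightarrow> nat \<Rightarrow> 'm) \<Rightarrow>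
     (nat \<Rightarrow> nat \<Rightarrow> 'm) \<Rightarrow> (crt_node, crt_edge, 'o, 'm) diagram" where
  "crt_diagram C n r D u v =
     \<lparr>Nodes = {Quot i |i. 1 \<le> i \<and> i \<le> n} \<union> {Push i j |i j. 1 \<le> i \<and> i < j \<and> j \<le> n},
      Edges = {Left i j |i j. 1 \<le> i \<and> i < j \<and> j \<le> n} \<union> {Right i j |i j. 1 \<le> i \<and> i < j \<and> j \<le> n},
      Src = (\<lambda>e. case e of Left i j \<Rightarrow> Quot i | Right i j \<Rightarrow> Quot j),
      Tgt = (\<lambda>e. case e of Left i j \<Rightarrow> Push i j | Right i j \<Rightarrow> Push i j),
      ObAt = (\<lambda>a. case a of Quot i \<Rightarrow> Cod C (r i) | Push i j \<Rightarrow> D i j),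
      MorAt = (\<lambda>e. case e of Left i j \<Rightarrow> u i j | Right i j \<Rightarrow> v i j)\<rparr>"

definition crt_cone ::
  "('o, 'm) cat \<Rightarrow> (nat \<Rightarrow> 'm) \<Rightarrow> (nat \<Rightarrow> nat \<Rightarrow> 'm) \<Rightarrow> crt_node \<Rightarrow> 'm" where
  "crt_cone C r u a = (case a of Quot i \<Rightarrow> r i | Push i j \<Rightarrow> u i j \<cdot>\<^bsub>C\<^esub> r i)"

definition CRT :: "('o, 'm) cat \<Rightarrow> nat \<Rightarrow> bool" where
  "CRT C n \<longleftrightarrow>
     (\<forall>X r. (\<forall>i. 1 \<le> i \<and> i \<le> n \<longrightarrow> regular_epi C (r i) \<and> Dom C (r i) = X) \<longrightarrow>
        (\<forall>i j. 1 \<le> i \<and> i < j \<and> j \<le> n \<longrightarrow> (\<exists>D u v. is_pushout C (r i) (r j) D u v)) \<and>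
        (\<forall>D u v L p.
           (\<forall>i j. 1 \<le> i \<and> i < j \<and> j \<le> n \<longrightarrow>
              is_pushout C (r i) (r j) (D i j) (u i j) (v i j)) \<and>
           is_limit C (crt_diagram C n r D u v) L p \<longrightarrow>
           regular_epi C (comparison C (crt_diagram C n r D u v) X (crt_cone C r u) L p)))"

end

(* Elements of an object are treated as generalized elements T -> X, and statements about them are
   local: they may be checked after composition with a regular epimorphism onto T. The condition
   CRT_n then says that pairwise compatible congruences modulo the kernels of r_1, ..., r_n have
   local simultaneous solutions. Applied to the two legs of a reflexive relation, CRT_2 exhibits the
   relation as the kernel pair of the pushout map, so it is an effective equivalence relation; CRT_3
   with right hand sides a, a, b is distributivity. Conversely, the pushout of two quotients is the
   quotient by the composite of their kernels, and a system of n congruences is solved one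
   congruence at a time, by dual distributivity, as in the lattice of ideals of an arithmetical
   ring. *)
theory Submission
  imports Defs
begin

section \<open>Categories and finite limits\<close>

text \<open>An existential statement about a quotient or a composite is realized only after a cover,
  so the argument keeps enlarging its cover. This does no harm: covers pull back along every element
  (\<open>Cover_lift\<close>, the stability axiom), they compose (\<open>Cover_comp\<close>), and
  membership in a relation descends along them, because regular epimorphisms have diagonal fillers
  against monomorphisms (\<open>rel_local\<close>). The way back from local solvability to a regular
  epimorphism is cancellation (\<open>Cover_right_cancel\<close>), applied to a solution over the
  generic element of the limit. The obstacle in the converse direction is that congruences that are
  solvable in pairs need not be solvable together. To add one more congruence, the pair formed by
  the partial solution and the new right hand side must lie in the join of the new kernel with the
  intersection of the old ones. The pairwise conditions place it only in the join with each old
  kernel separately, and dual distributivity closes exactly this gap.\<close>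

context category
begin

lemma comp_simps [simp]:
  assumes "f \<in> Mor C" "g \<in> Mor C" "Cod C f = Dom C g"
  shows "g \<cdot> f \<in> Mor C" "Dom C (g \<cdot> f) = Dom C f" "Cod C (g \<cdot> f) = Cod C g"
  using Comp_closed[of f "Dom C f" "Cod C f" g "Cod C g"] assms by (auto simp: Hom_def)

lemma comp_assoc [simp]:
  assumes "f \<in> Mor C" "g \<in> Mor C" "h \<in> Mor C" "Cod C f = Dom C g" "Cod C g = Dom C h"
  shows "(h \<cdot> g) \<cdot> f = h \<cdot> (g \<cdot> f)"
  using Comp_assoc[of f "Dom C f" "Cod C f" g "Cod C g" h "Cod C h"] assms by (auto simp: Hom_def)

lemma Ident_simps [simp]:
  assumes "X \<in> Obj C"
  shows "Ident C X \<in> Mor C" "Dom C (Ident C X) = X" "Cod C (Ident C X) = X"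
  using Ident_closed[OF assms] by (auto simp: Hom_def)

lemma comp_Ident_simps [simp]:
  assumes "f \<in> Mor C"
  shows "Dom C f = X \<Longrightarrow> f \<cdot> Ident C X = f" "Cod C f = Y \<Longrightarrow> Ident C Y \<cdot> f = f"
  using assms Comp_Ident[of f X "Cod C f"] Ident_Comp[of f "Dom C f" Y] by (auto simp: Hom_def)

lemma Dom_Cod_Obj [simp]:
  assumes "f \<in> Mor C"
  shows "Dom C f \<in> Obj C" "Cod C f \<in> Obj C"
  using assms Dom_closed Cod_closed by auto

lemma Hom_Obj:
  assumes "f \<in> Hom C X Y"
  shows "X \<in> Obj C" "Y \<in> Obj C"
  using assms Dom_closed Cod_closed by (auto simp: Hom_def)

text \<open>Composites are kept nested to the right, so an equation for \<open>g \<cdot> f\<close>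
  no longer matches inside a longer composite; this is its version for that situation. With
  \<open>refl\<close> as the equation it is associativity, typed by hom sets.\<close>

lemma comp_comp_eq:
  assumes "g \<cdot> f = k" "e \<in> Hom C W X" "f \<in> Hom C X Y" "g \<in> Hom C Y Z"
  shows "g \<cdot> (f \<cdot> e) = k \<cdot> e"
  using assms by (auto simp: Hom_def)

lemma Hom_comp:
  assumes "e \<in> Hom C W X" "f \<in> Hom C X Y"
  shows "f \<cdot> e \<in> Hom C W Y"
  using assms by (auto simp: Hom_def)

lemma monicD:
  assumes "monic C m" "m \<cdot> f = m \<cdot> g" "f \<in> Hom C Y (Dom C m)" "g \<in> Hom C Y (Dom C m)"
  shows "f = g"
  using assms by (auto simp: monic_def)

section \<open>Pullbacks, coequalizers and regular epimorphisms in an arbitrary category\<close>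

lemma pullback_Hom:
  assumes "is_pullback C f g P p q" "f \<in> Hom C X Z" "g \<in> Hom C Y Z"
  shows "p \<in> Hom C P X" "q \<in> Hom C P Y" "f \<cdot> p = g \<cdot> q"
  using assms by (simp_all add: is_pullback_def Hom_def)

lemma pullback_lift:
  assumes "is_pullback C f g P p q" "f \<in> Hom C X Z" "g \<in> Hom C Y Z"
    "a \<in> Hom C W X" "b \<in> Hom C W Y" "f \<cdot> a = g \<cdot> b"
  shows "\<exists>h \<in> Hom C W P. p \<cdot> h = a \<and> q \<cdot> h = b"
proof -
  have "a \<in> Hom C W (Dom C f)" "b \<in> Hom C W (Dom C g)"
    using assms by (simp_all add: Hom_def)
  with assms(1,6) show ?thesis
    unfolding is_pullback_def by blast
qed

lemma pullback_eqI:
  assumes "is_pullback C f g P p q" "f \<in> Hom C X Z" "g \<in> Hom C Y Z"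
    "h \<in> Hom C W P" "k \<in> Hom C W P" "p \<cdot> h = p \<cdot> k" "q \<cdot> h = q \<cdot> k"
  shows "h = k"
proof -
  note pq = pullback_Hom[OF assms(1-3)]
  have "p \<cdot> k \<in> Hom C W (Dom C f)" "q \<cdot> k \<in> Hom C W (Dom C g)" "f \<cdot> (p \<cdot> k) = g \<cdot> (q \<cdot> k)"
    using assms(2,3,5) pq comp_comp_eq[OF pq(3) assms(5) pq(1) assms(2)] by (auto simp: Hom_def)
  with assms(1,4-7) show ?thesis
    unfolding is_pullback_def by blast
qed

lemma coequalizer_lift:
  assumes "is_coequalizer C f g q" "f \<in> Hom C W X" "t \<in> Hom C X Z" "t \<cdot> f = t \<cdot> g" "q \<in> Hom C X Y"
  shows "\<exists>h \<in> Hom C Y Z. h \<cdot> q = t"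
proof -
  have "t \<in> Hom C (Cod C f) Z" "Cod C q = Y"
    using assms by (simp_all add: Hom_def)
  with assms(1,4) show ?thesis
    unfolding is_coequalizer_def by blast
qed

lemma regular_epi_cancel:
  assumes "regular_epi C q" "q \<in> Hom C X Y" "a \<in> Hom C Y Z" "b \<in> Hom C Y Z" "a \<cdot> q = b \<cdot> q"
  shows "a = b"
proof -
  obtain f g where q: "is_coequalizer C f g q"
    using assms(1) by (auto simp: regular_epi_def)
  have "b \<cdot> q \<in> Hom C (Cod C f) Z" "(b \<cdot> q) \<cdot> f = (b \<cdot> q) \<cdot> g"
    using assms(2-4) q by (auto simp: is_coequalizer_def Hom_def)
  with q have "\<exists>!h. h \<in> Hom C (Cod C q) Z \<and> h \<cdot> q = b \<cdot> q"
    unfolding is_coequalizer_def by blast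
  then show ?thesis
    using assms(2-5) by (auto simp: Hom_def)
qed

text \<open>\<open>d\<close> is the coequalizer of the idempotent \<open>e \<cdot> d\<close> and the
  identity: a map \<open>t\<close> that coequalizes them factors as \<open>t \<cdot> e\<close> after
  \<open>d\<close>. The legs of a reflexive relation become quotients in this way.\<close>

lemma split_epi_regular:
  assumes "d \<in> Hom C E X" "e \<in> Hom C X E" "d \<cdot> e = Ident C X"
  shows "regular_epi C d"
proof -
  have de: "d \<in> Mor C" "Dom C d = E" "Cod C d = X" "e \<in> Mor C" "Dom C e = X" "Cod C e = E"
    using assms by (auto simp: Hom_def)
  have obj: "E \<in> Obj C" "X \<in> Obj C"
    using assms(1) Hom_Obj by auto
  have "is_coequalizer C (e \<cdot> d) (Ident C E) d"
    unfolding is_coequalizer_def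
  proof (intro conjI allI ballI impI)
    show "d \<cdot> e \<cdot> d = d \<cdot> Ident C E"
      using de obj comp_comp_eq[OF assms(3,1,2,1)] by simp
    fix Z t
    assume "t \<in> Hom C (Cod C (e \<cdot> d)) Z" and eq: "t \<cdot> e \<cdot> d = t \<cdot> Ident C E"
    then have t: "t \<in> Mor C" "Dom C t = E" "Cod C t = Z"
      using de by (auto simp: Hom_def)
    show "\<exists>!h. h \<in> Hom C (Cod C d) Z \<and> h \<cdot> d = t"
    proof (rule ex1I[of _ "t \<cdot> e"])
      show "t \<cdot> e \<in> Hom C (Cod C d) Z \<and> (t \<cdot> e) \<cdot> d = t"
        using t de eq by (auto simp: Hom_def)
      fix h assume h: "h \<in> Hom C (Cod C d) Z \<and> h \<cdot> d = t"
      then have "h = h \<cdot> d \<cdot> e"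
        using de assms(3) by (auto simp: Hom_def)
      also have "\<dots> = t \<cdot> e"
        using h de by (auto simp: Hom_def)
      finally show "h = t \<cdot> e" .
    qed
  qed (use de obj in auto)
  then show ?thesis
    by (auto simp: regular_epi_def)
qed

lemma Ident_regular_epi: "X \<in> Obj C \<Longrightarrow> regular_epi C (Ident C X)"
  by (rule split_epi_regular[of _ X X "Ident C X"]) (auto simp: Hom_def)

text \<open>If \<open>q\<close> is the coequalizer of \<open>f\<close> and \<open>g\<close>, then
  \<open>a \<cdot> f\<close> and \<open>a \<cdot> g\<close> agree after the monic \<open>m\<close>,
  so they agree and \<open>a\<close> factors through \<open>q\<close>. This orthogonality is the
  source of all descent along covers.\<close>

lemma regular_epi_diagonal:
  assumes "regular_epi C q" "q \<in> Hom C X Y" "monic C m" "a \<in> Hom C X (Dom C m)"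
    "b \<in> Hom C Y (Cod C m)" "m \<cdot> a = b \<cdot> q"
  shows "\<exists>d \<in> Hom C Y (Dom C m). d \<cdot> q = a \<and> m \<cdot> d = b"
proof -
  obtain f g where q: "is_coequalizer C f g q"
    using assms(1) by (auto simp: regular_epi_def)
  then have fg: "f \<in> Hom C (Dom C f) X" "g \<in> Hom C (Dom C f) X" "q \<cdot> f = q \<cdot> g" "Cod C f = X"
    using assms(2) by (auto simp: is_coequalizer_def Hom_def)
  have m: "m \<in> Hom C (Dom C m) (Cod C m)"
    using assms(3) by (auto simp: monic_def Hom_def)
  have "m \<cdot> (a \<cdot> f) = b \<cdot> (q \<cdot> f)" "m \<cdot> (a \<cdot> g) = b \<cdot> (q \<cdot> g)"
    using comp_comp_eq[OF assms(6) fg(1) assms(4) m] comp_comp_eq[OF assms(6) fg(2) assms(4) m]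
      assms(2,5) fg by (auto simp: Hom_def)
  with fg(3) have "m \<cdot> (a \<cdot> f) = m \<cdot> (a \<cdot> g)"
    by simp
  then have "a \<cdot> f = a \<cdot> g"
    by (rule monicD[OF assms(3) _ Hom_comp[OF fg(1) assms(4)] Hom_comp[OF fg(2) assms(4)]])
  then obtain d where d: "d \<in> Hom C Y (Dom C m)" "d \<cdot> q = a"
  proof -
    have "a \<in> Hom C (Cod C f) (Dom C m)" "Cod C q = Y"
      using assms(2,4) fg(4) by (auto simp: Hom_def)
    then show ?thesis
      using q \<open>a \<cdot> f = a \<cdot> g\<close> that unfolding is_coequalizer_def by blast
  qed
  have "(m \<cdot> d) \<cdot> q = b \<cdot> q"
    using d m assms(2,6) by (auto simp: Hom_def)
  then have "m \<cdot> d = b"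
    using regular_epi_cancel[OF assms(1,2) Hom_comp[OF d(1) m] assms(5)] by auto
  with d show ?thesis
    by auto
qed

text \<open>A coequalizer is determined up to isomorphism of its codomain: a factorization
  \<open>h\<close> through \<open>q\<close> becomes \<open>h \<cdot> d\<close> through
  \<open>m \<cdot> q\<close>.\<close>

lemma regular_epi_iso_comp:
  assumes "regular_epi C q" "q \<in> Hom C X Y" "m \<in> Hom C Y Z" "d \<in> Hom C Z Y"
    "m \<cdot> d = Ident C Z" "d \<cdot> m = Ident C Y"
  shows "regular_epi C (m \<cdot> q)"
proof -
  obtain f g where q: "is_coequalizer C f g q"
    using assms(1) by (auto simp: regular_epi_def)
  have ty: "q \<in> Mor C" "Dom C q = X" "Cod C q = Y" "m \<in> Mor C" "Dom C m = Y" "Cod C m = Z"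
    "d \<in> Mor C" "Dom C d = Z" "Cod C d = Y"
    "f \<in> Mor C" "g \<in> Mor C" "Dom C f = Dom C g" "Cod C f = X" "Cod C g = X" "q \<cdot> f = q \<cdot> g"
    using assms q by (auto simp: Hom_def is_coequalizer_def)
  have "is_coequalizer C f g (m \<cdot> q)"
    unfolding is_coequalizer_def
  proof (intro conjI allI ballI impI)
    fix W t assume t: "t \<in> Hom C (Cod C f) W" "t \<cdot> f = t \<cdot> g"
    then obtain h where h: "h \<in> Hom C Y W" "h \<cdot> q = t"
      using q ty unfolding is_coequalizer_def by blast
    have dmq: "d \<cdot> (m \<cdot> q) = q"
      using comp_comp_eq[OF assms(6,2,3,4)] ty by simp
    show "\<exists>!h. h \<in> Hom C (Cod C (m \<cdot> q)) W \<and> h \<cdot> m \<cdot> q = t"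
    proof (rule ex1I[of _ "h \<cdot> d"])
      show "h \<cdot> d \<in> Hom C (Cod C (m \<cdot> q)) W \<and> (h \<cdot> d) \<cdot> m \<cdot> q = t"
        using ty h dmq by (auto simp: Hom_def)
      fix k assume k: "k \<in> Hom C (Cod C (m \<cdot> q)) W \<and> k \<cdot> m \<cdot> q = t"
      then have k': "k \<in> Hom C Z W"
        using ty by (auto simp: Hom_def)
      have "k \<cdot> m = h"
        by (rule regular_epi_cancel[OF assms(1,2) _ h(1)]) (use k h ty in \<open>auto simp: Hom_def\<close>)
      with k' show "k = h \<cdot> d"
        using ty assms(5) by (auto simp: Hom_def)
    qed
  qed (use ty in auto)
  then show ?thesis
    by (auto simp: regular_epi_def)
qed

text \<open>\<open>finitely_complete\<close> speaks only of graphs labelled by natural numbers.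
  Injective numberings of the nodes and edges transport cones and their morphisms in both
  directions, which frees the label types.\<close>

lemma finite_limit_exists:
  fixes G :: "('v, 'e, 'o, 'm) diagram"
  assumes "finitely_complete C" "is_diagram C G" "finite (Nodes G)" "finite (Edges G)"
  shows "\<exists>L p. is_limit C G L p"
proof -
  obtain f :: "'v \<Rightarrow> nat" where f: "inj_on f (Nodes G)"
    using finite_imp_inj_to_nat_seg[OF assms(3)] by blast
  obtain g :: "'e \<Rightarrow> nat" where g: "inj_on g (Edges G)"
    using finite_imp_inj_to_nat_seg[OF assms(4)] by blast
  define f' g' where "f' = inv_into (Nodes G) f" and "g' = inv_into (Edges G) g"
  have inv: "f' (f v) = v" if "v \<in> Nodes G" for v
    using that f by (simp add: f'_def)
  have inv_g: "g' (g e) = e" if "e \<in> Edges G" for e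
    using that g by (simp add: g'_def)
  define H :: "(nat, nat, 'o, 'm) diagram" where
    "H = \<lparr>Nodes = f ` Nodes G, Edges = g ` Edges G, Src = (\<lambda>k. f (Src G (g' k))),
      Tgt = (\<lambda>k. f (Tgt G (g' k))), ObAt = (\<lambda>k. ObAt G (f' k)), MorAt = (\<lambda>k. MorAt G (g' k))\<rparr>"
  have st: "Src G e \<in> Nodes G" "Tgt G e \<in> Nodes G" if "e \<in> Edges G" for e
    using that assms(2) by (auto simp: is_diagram_def)
  have "is_diagram C H"
    using assms(2) by (auto simp: is_diagram_def H_def inv inv_g)
  moreover have "finite (Nodes H)" "finite (Edges H)"
    using assms by (auto simp: H_def)
  ultimately obtain L p where L: "is_limit C H L p"
    using assms(1) unfolding finitely_complete_def by blast
  have cone: "is_cone C H Y q \<longleftrightarrow> is_cone C G Y (q \<circ> f)" for Y q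
    using st by (auto simp: is_cone_def H_def inv inv_g)
  have cone': "is_cone C G Y q \<longleftrightarrow> is_cone C H Y (q \<circ> f')" for Y q
    using st by (auto simp: is_cone_def H_def inv inv_g)
  have mor: "is_cone_morphism C H Y (q \<circ> f') L p h \<longleftrightarrow> is_cone_morphism C G Y q L (p \<circ> f) h"
    for Y q h
    by (auto simp: is_cone_morphism_def H_def inv)
  have "is_limit C G L (p \<circ> f)"
    using L unfolding is_limit_def by (metis cone cone' mor)
  then show ?thesis
    by blast
qed

lemma product_exists:
  assumes "finitely_complete C" "X \<in> Obj C" "Y \<in> Obj C"
  shows "\<exists>P p q. is_product C X Y P p q"
proof -
  define G :: "(bool, unit, 'o, 'm) diagram" where
    "G = \<lparr>Nodes = UNIV, Edges = {}, Src = (\<lambda>_. True), Tgt = (\<lambda>_. True),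
      ObAt = (\<lambda>b. if b then X else Y), MorAt = (\<lambda>_. undefined)\<rparr>"
  have "is_diagram C G"
    using assms by (auto simp: is_diagram_def G_def)
  then obtain L p where L: "is_limit C G L p"
    using finite_limit_exists[OF assms(1), of G] by (auto simp: G_def)
  have "is_product C X Y L (p True) (p False)"
    unfolding is_product_def
  proof (intro conjI allI ballI)
    show "p True \<in> Hom C L X" "p False \<in> Hom C L Y"
      using L by (auto simp: is_limit_def is_cone_def G_def split: if_splits)
    fix Z f g assume fg: "f \<in> Hom C Z X" "g \<in> Hom C Z Y"
    then have "is_cone C G Z (\<lambda>b. if b then f else g)"
      using Hom_Obj by (auto simp: is_cone_def G_def)
    then have "\<exists>!h. is_cone_morphism C G Z (\<lambda>b. if b then f else g) L p h"
      using L by (auto simp: is_limit_def)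
    then show "\<exists>!h. h \<in> Hom C Z L \<and> p True \<cdot> h = f \<and> p False \<cdot> h = g"
      by (simp add: is_cone_morphism_def G_def all_bool_eq)
  qed
  then show ?thesis
    by blast
qed

text \<open>The cospan, seen as a graph, has a third node for the common codomain. The leg to that
  node is forced to be \<open>f\<close> after the first leg, so cones over the graph are the
  commutative squares.\<close>

lemma pullback_exists:
  assumes "finitely_complete C" "f \<in> Hom C X Z" "g \<in> Hom C Y Z"
  shows "\<exists>P p q. is_pullback C f g P p q"
proof -
  define G :: "(nat, bool, 'o, 'm) diagram" where
    "G = \<lparr>Nodes = {0, 1, 2}, Edges = UNIV, Src = (\<lambda>b. if b then 0 else 1), Tgt = (\<lambda>_. 2),
      ObAt = (\<lambda>i. if i = 0 then X else if i = 1 then Y else Z), MorAt = (\<lambda>b. if b then f else g)\<rparr>"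
  have ty: "f \<in> Mor C" "g \<in> Mor C" "Dom C f = X" "Dom C g = Y" "Cod C f = Z" "Cod C g = Z"
    using assms by (auto simp: Hom_def)
  have "is_diagram C G"
    using assms Hom_Obj by (auto simp: is_diagram_def G_def)
  then obtain L p where L: "is_limit C G L p"
    using finite_limit_exists[OF assms(1), of G] by (auto simp: G_def)
  then have p: "p 0 \<in> Hom C L X" "p 1 \<in> Hom C L Y" "f \<cdot> p 0 = p 2" "g \<cdot> p 1 = p 2"
    by (auto simp: is_limit_def is_cone_def G_def split: if_splits)
  have "is_pullback C f g L (p 0) (p 1)"
    unfolding is_pullback_def
  proof (intro conjI allI ballI impI)
    fix W a b assume ab: "a \<in> Hom C W (Dom C f)" "b \<in> Hom C W (Dom C g)" "f \<cdot> a = g \<cdot> b"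
    define q where "q = (\<lambda>i::nat. if i = 0 then a else if i = 1 then b else f \<cdot> a)"
    have "is_cone C G W q"
      using ab ty Hom_Obj[OF ab(1)] by (auto simp: is_cone_def G_def q_def Hom_def)
    then have ex: "\<exists>!h. is_cone_morphism C G W q L p h"
      using L by (auto simp: is_limit_def)
    have "p 2 \<cdot> h = f \<cdot> a" if "h \<in> Hom C W L" "p 0 \<cdot> h = a" for h
      using that p ty comp_comp_eq[OF p(3) that(1) p(1) assms(2)] by auto
    then have "is_cone_morphism C G W q L p h \<longleftrightarrow> h \<in> Hom C W L \<and> p 0 \<cdot> h = a \<and> p 1 \<cdot> h = b" for h
      by (auto simp: is_cone_morphism_def G_def q_def)
    with ex show "\<exists>!h. h \<in> Hom C W L \<and> p 0 \<cdot> h = a \<and> p 1 \<cdot> h = b"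
      by simp
  qed (use p ty in auto)
  then show ?thesis
    by blast
qed

end


section \<open>Regular categories\<close>

locale regular = category C for C :: "('o, 'm) cat" (structure) +
  assumes regular: "regular_category C"
begin

text \<open>A cover of \<open>T\<close> is a regular epimorphism onto \<open>T\<close>: a statement about generalized elements
  of shape \<open>T\<close> holds locally if it holds after composition with a cover.\<close>

definition Cover :: "'o \<Rightarrow> 'o \<Rightarrow> 'm set" where
  "Cover T' T = {e \<in> Hom C T' T. regular_epi C e}"

lemma CoverD:
  assumes "e \<in> Cover T' T"
  shows "e \<in> Hom C T' T" "regular_epi C e"
  using assms by (auto simp: Cover_def)

lemma Cover_Ident: "T \<in> Obj C \<Longrightarrow> Ident C T \<in> Cover T T"
  using Ident_regular_epi by (auto simp: Cover_def Hom_def)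

lemma Cover_cancel:
  assumes "e \<in> Cover T' T" "a \<in> Hom C T X" "b \<in> Hom C T X" "a \<cdot> e = b \<cdot> e"
  shows "a = b"
  using assms regular_epi_cancel by (auto simp: Cover_def)

lemma finitely_complete: "finitely_complete C"
  using regular by (auto simp: regular_category_def)

text \<open>The pullback of \<open>q\<close> along \<open>y\<close> is again a regular epimorphism.
  Read in elements, this says that every element of a quotient lifts locally.\<close>

lemma Cover_lift:
  assumes "q \<in> Cover X Y" "y \<in> Hom C T Y"
  shows "\<exists>T' e x. e \<in> Cover T' T \<and> x \<in> Hom C T' X \<and> q \<cdot> x = y \<cdot> e"
proof -
  obtain P p p' where P: "is_pullback C q y P p p'"
    using pullback_exists[OF finitely_complete CoverD(1)[OF assms(1)] assms(2)] by blast
  then have "regular_epi C p'"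
    using regular assms unfolding regular_category_def Cover_def by blast
  with P show ?thesis
    using assms by (intro exI[of _ P] exI[of _ p'] exI[of _ p]) (auto simp: Cover_def is_pullback_def Hom_def)
qed

text \<open>The image is the quotient of \<open>X\<close> by the kernel pair of \<open>f\<close>.
  For monicity, elements of the quotient with the same value under \<open>m\<close> are lifted
  locally to \<open>X\<close>; the lifts have the same value under \<open>f\<close>, hence form an
  element of the kernel pair and are identified by \<open>q\<close>.\<close>

lemma regular_mono_factorization:
  assumes "f \<in> Hom C X Y"
  shows "\<exists>I q m. q \<in> Cover X I \<and> monic C m \<and> m \<in> Hom C I Y \<and> f = m \<cdot> q"
proof -
  obtain K k l where K: "is_pullback C f f K k l"
    using pullback_exists[OF finitely_complete assms assms] by auto
  then obtain q where q: "is_coequalizer C k l q"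
    using regular unfolding regular_category_def is_kernel_pair_def by blast
  define I where "I = Cod C q"
  have kl: "k \<in> Hom C K X" "l \<in> Hom C K X" "f \<cdot> k = f \<cdot> l"
    using K assms by (auto simp: is_pullback_def Hom_def)
  have qkl: "q \<cdot> k = q \<cdot> l" and "q \<in> Hom C X I"
    using q kl by (simp_all add: is_coequalizer_def Hom_def I_def)
  then have qC: "q \<in> Cover X I"
    using q by (auto simp: Cover_def regular_epi_def)
  note qH = CoverD(1)[OF qC]
  have "f \<in> Hom C (Cod C k) Y"
    using kl(1) assms by (auto simp: Hom_def)
  then obtain m where m: "m \<in> Hom C I Y" "m \<cdot> q = f"
    using q kl(3) unfolding is_coequalizer_def I_def by blast
  have "monic C m"
    unfolding monic_def
  proof (intro conjI allI ballI impI)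
    show "m \<in> Mor C"
      using m by (auto simp: Hom_def)
    fix T a b assume "a \<in> Hom C T (Dom C m)" "b \<in> Hom C T (Dom C m)" and eq: "m \<cdot> a = m \<cdot> b"
    then have ab: "a \<in> Hom C T I" "b \<in> Hom C T I"
      using m by (auto simp: Hom_def)
    \<comment> \<open>The two lifts need a common shape: \<open>a\<close> is lifted over a cover
      \<open>d\<close>, and then \<open>b \<cdot> d\<close> over a further cover
      \<open>e\<close>.\<close>
    obtain T1 d x where d: "d \<in> Cover T1 T" "x \<in> Hom C T1 X" "q \<cdot> x = a \<cdot> d"
      using Cover_lift[OF qC ab(1)] by blast
    note dH = CoverD(1)[OF d(1)]
    obtain T2 e y where e: "e \<in> Cover T2 T1" "y \<in> Hom C T2 X" "q \<cdot> y = (b \<cdot> d) \<cdot> e"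
      using Cover_lift[OF qC Hom_comp[OF dH ab(2)]] by blast
    note eH = CoverD(1)[OF e(1)]
    have xe: "q \<cdot> (x \<cdot> e) = (a \<cdot> d) \<cdot> e"
      by (rule comp_comp_eq[OF d(3) eH d(2) qH])
    have "f \<cdot> (x \<cdot> e) = m \<cdot> (q \<cdot> (x \<cdot> e))"
      using comp_comp_eq[OF m(2) Hom_comp[OF eH d(2)] qH m(1)] by simp
    also have "\<dots> = m \<cdot> (a \<cdot> (d \<cdot> e))"
      using xe dH eH ab by (auto simp: Hom_def)
    also have "\<dots> = m \<cdot> (b \<cdot> (d \<cdot> e))"
      using eq m ab Hom_comp[OF eH dH] comp_comp_eq[OF eq Hom_comp[OF eH dH] ab(1) m(1)]
      by (auto simp: Hom_def)
    also have "\<dots> = m \<cdot> (q \<cdot> y)"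
      using e dH eH ab by (auto simp: Hom_def)
    also have "\<dots> = f \<cdot> y"
      using comp_comp_eq[OF m(2) e(2) qH m(1)] by simp
    finally obtain h where h: "h \<in> Hom C T2 K" "k \<cdot> h = x \<cdot> e" "l \<cdot> h = y"
      using pullback_lift[OF K assms assms Hom_comp[OF eH d(2)] e(2)] by blast
    have "q \<cdot> (x \<cdot> e) = q \<cdot> y"
      using comp_comp_eq[OF qkl h(1) kl(1) qH] comp_comp_eq[OF refl h(1) kl(2) qH] h by simp
    then have "a \<cdot> d = b \<cdot> d"
      using xe e Cover_cancel[OF e(1) Hom_comp[OF dH ab(1)] Hom_comp[OF dH ab(2)]] by simp
    then show "a = b"
      using Cover_cancel[OF d(1) ab] by simp
  qed
  with m qC show ?thesis
    by blast
qed

lemma monic_section: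
  assumes "monic C m" "m \<in> Hom C X Y" "d \<in> Hom C Y X" "m \<cdot> d = Ident C Y"
  shows "d \<cdot> m = Ident C X"
proof (rule monicD[OF assms(1), of _ _ X])
  have ty: "m \<in> Mor C" "Dom C m = X" "Cod C m = Y" "d \<in> Mor C" "Dom C d = Y" "Cod C d = X"
    "X \<in> Obj C"
    using assms Hom_Obj[OF assms(2)] by (auto simp: Hom_def)
  then show "m \<cdot> d \<cdot> m = m \<cdot> Ident C X"
    using comp_comp_eq[OF assms(4,2,3,2)] by simp
  show "d \<cdot> m \<in> Hom C X (Dom C m)" "Ident C X \<in> Hom C X (Dom C m)"
    using ty by (auto simp: Hom_def)
qed

text \<open>A monomorphism with a right inverse is an isomorphism. This is the common last step of
  the two lemmas that follow.\<close>

lemma Cover_monic_comp: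
  assumes "q \<in> Cover X Y" "monic C m" "m \<in> Hom C Y Z" "d \<in> Hom C Z Y" "m \<cdot> d = Ident C Z"
  shows "m \<cdot> q \<in> Cover X Z"
  using regular_epi_iso_comp[OF CoverD(2,1)[OF assms(1)] assms(3,4,5) monic_section[OF assms(2-5)]]
    Hom_comp[OF CoverD(1)[OF assms(1)] assms(3)] by (simp add: Cover_def)

text \<open>It suffices that the monic part \<open>m\<close> of \<open>q \<cdot> p\<close> splits.
  Filling the square of \<open>p\<close> against \<open>m\<close> lifts \<open>q\<close> through
  \<open>m\<close>; filling the square of \<open>q\<close> against \<open>m\<close> then lifts the
  identity of \<open>Z\<close>.\<close>

lemma Cover_comp:
  assumes "p \<in> Cover X Y" "q \<in> Cover Y Z"
  shows "q \<cdot> p \<in> Cover X Z"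
proof -
  note H = CoverD(1)[OF assms(1)] CoverD(1)[OF assms(2)]
  obtain I e m where e: "e \<in> Cover X I" "monic C m" "m \<in> Hom C I Z" "q \<cdot> p = m \<cdot> e"
    using regular_mono_factorization[OF Hom_comp[OF H]] by blast
  have m: "Dom C m = I" "Cod C m = Z"
    using e(3) by (auto simp: Hom_def)
  obtain d where d: "d \<in> Hom C Y I" "m \<cdot> d = q"
    using regular_epi_diagonal[OF CoverD(2)[OF assms(1)] H(1) e(2), of e q] e(4) CoverD(1)[OF e(1)] H m
    by auto
  have Z: "Z \<in> Obj C"
    using H(2) Hom_Obj by auto
  obtain d' where "d' \<in> Hom C Z I" "m \<cdot> d' = Ident C Z"
    using regular_epi_diagonal[OF CoverD(2)[OF assms(2)] H(2) e(2), of d "Ident C Z"] d m Z H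
    by (auto simp: Hom_def)
  then show ?thesis
    using Cover_monic_comp[OF e(1-3)] e(4) by simp
qed

text \<open>The monic part of \<open>g\<close> is one through which the cover
  \<open>g \<cdot> f\<close> factors, so a diagonal filler splits it. This turns a local preimage of
  a generic element into a regular epimorphism.\<close>

lemma Cover_right_cancel:
  assumes "g \<cdot> f \<in> Cover X Z" "f \<in> Hom C X Y" "g \<in> Hom C Y Z"
  shows "g \<in> Cover Y Z"
proof -
  obtain I e m where e: "e \<in> Cover Y I" "monic C m" "m \<in> Hom C I Z" "g = m \<cdot> e"
    using regular_mono_factorization[OF assms(3)] by blast
  have m: "Dom C m = I" "Cod C m = Z" "Z \<in> Obj C"
    using e(3) Hom_Obj by (auto simp: Hom_def)
  have "m \<cdot> (e \<cdot> f) = Ident C Z \<cdot> (g \<cdot> f)"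
    using assms e(1,3,4) m CoverD(1)[OF e(1)] by (auto simp: Hom_def)
  then obtain d where "d \<in> Hom C Z I" "m \<cdot> d = Ident C Z"
    using regular_epi_diagonal[OF CoverD(2,1)[OF assms(1)] e(2), of "e \<cdot> f" "Ident C Z"]
      m Hom_comp[OF assms(2) CoverD(1)[OF e(1)]] by (auto simp: Hom_def)
  then show ?thesis
    using Cover_monic_comp[OF e(1-3)] e(4) by simp
qed

text \<open>\<open>q\<close> is the coequalizer of some pair, and that pair factors through the
  kernel pair; so whatever equalizes \<open>k\<close> and \<open>l\<close> also equalizes that
  pair.\<close>

lemma Cover_coequalizer:
  assumes "q \<in> Cover X Y" "is_pullback C q q K k l"
  shows "is_coequalizer C k l q"
proof -
  obtain f g where fg: "is_coequalizer C f g q"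
    using assms(1) by (auto simp: Cover_def regular_epi_def)
  note qH = CoverD(1)[OF assms(1)]
  have kl: "k \<in> Hom C K X" "l \<in> Hom C K X" "q \<cdot> k = q \<cdot> l"
    using assms(2) qH by (auto simp: is_pullback_def Hom_def)
  have fgH: "f \<in> Hom C (Dom C f) X" "g \<in> Hom C (Dom C f) X" "q \<cdot> f = q \<cdot> g"
    using fg qH by (auto simp: is_coequalizer_def Hom_def)
  then obtain h where h: "h \<in> Hom C (Dom C f) K" "k \<cdot> h = f" "l \<cdot> h = g"
    using pullback_lift[OF assms(2) qH qH] by blast
  have "\<exists>d \<in> Hom C Y Z. d \<cdot> q = t" if t: "t \<in> Hom C X Z" "t \<cdot> k = t \<cdot> l" for Z t
  proof -
    have "(t \<cdot> k) \<cdot> h = (t \<cdot> l) \<cdot> h"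
      using t(2) by simp
    then have "t \<cdot> f = t \<cdot> g"
      using h kl t(1) by (simp add: Hom_def)
    then show ?thesis
      using coequalizer_lift[OF fg fgH(1) t(1) _ qH] by blast
  qed
  then have ex: "\<exists>!d. d \<in> Hom C Y Z \<and> d \<cdot> q = t" if "t \<in> Hom C X Z" "t \<cdot> k = t \<cdot> l" for Z t
    using that Cover_cancel[OF assms(1)] by metis
  have ty: "Cod C k = X" "Cod C q = Y"
    using kl qH by (simp_all add: Hom_def)
  show ?thesis
    unfolding is_coequalizer_def ty using ex kl qH by (simp add: Hom_def)
qed

end


section \<open>Internal relations through generalized elements\<close>

locale regular_object = regular C for C :: "('o, 'm) cat" (structure) +
  fixes X :: 'o
  assumes X: "X \<in> Obj C"
begin

text \<open>The functor of points of the subobject \<open>m\<close>: the pairs of elements of shape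
  \<open>T\<close> that factor through it. Inclusions and properties of relations become statements
  about this predicate.\<close>

definition rel :: "'m \<Rightarrow> 'o \<Rightarrow> 'm \<Rightarrow> 'm \<Rightarrow> bool" where
  "rel m T a b \<longleftrightarrow> (\<exists>k \<in> Hom C T (Dom C m). leg1 C X m \<cdot> k = a \<and> leg2 C X m \<cdot> k = b)"

lemma square_product: "is_product C X X (square_obj C X) (proj1 C X) (proj2 C X)"
proof -
  obtain P p q where "is_product C X X P p q"
    using product_exists[OF finitely_complete X X] by blast
  then have "\<exists>s. case s of (P, p, q) \<Rightarrow> is_product C X X P p q"
    by auto
  from someI_ex[OF this] have "case square C X of (P, p, q) \<Rightarrow> is_product C X X P p q"
    unfolding square_def .
  then show ?thesis
    by (simp add: square_obj_def proj1_def proj2_def case_prod_unfold)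
qed

lemma proj_Hom: "proj1 C X \<in> Hom C (square_obj C X) X" "proj2 C X \<in> Hom C (square_obj C X) X"
  using square_product by (auto simp: is_product_def)

lemma pair_exists:
  assumes "a \<in> Hom C T X" "b \<in> Hom C T X"
  shows "\<exists>h \<in> Hom C T (square_obj C X). proj1 C X \<cdot> h = a \<and> proj2 C X \<cdot> h = b"
  using square_product assms unfolding is_product_def by blast

lemma pair_eqI:
  assumes "h \<in> Hom C T (square_obj C X)" "k \<in> Hom C T (square_obj C X)"
    "proj1 C X \<cdot> h = proj1 C X \<cdot> k" "proj2 C X \<cdot> h = proj2 C X \<cdot> k"
  shows "h = k"
proof -
  have "proj1 C X \<cdot> k \<in> Hom C T X" "proj2 C X \<cdot> k \<in> Hom C T X"
    using proj_Hom[THEN Hom_comp[OF assms(2)]] .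
  then show ?thesis
    using square_product assms unfolding is_product_def by blast
qed

lemma is_relation_Hom:
  assumes "is_relation C X m"
  shows "m \<in> Hom C (Dom C m) (square_obj C X)"
    "leg1 C X m \<in> Hom C (Dom C m) X" "leg2 C X m \<in> Hom C (Dom C m) X"
proof -
  show m: "m \<in> Hom C (Dom C m) (square_obj C X)"
    using assms by (auto simp: is_relation_def monic_def Hom_def)
  show "leg1 C X m \<in> Hom C (Dom C m) X" "leg2 C X m \<in> Hom C (Dom C m) X"
    using Hom_comp[OF m] proj_Hom by (auto simp: leg1_def leg2_def)
qed

lemma leg_comp:
  assumes "is_relation C X m" "k \<in> Hom C T (Dom C m)"
  shows "leg1 C X m \<cdot> k = proj1 C X \<cdot> (m \<cdot> k)" "leg2 C X m \<cdot> k = proj2 C X \<cdot> (m \<cdot> k)"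
  using assms is_relation_Hom[OF assms(1)] proj_Hom by (auto simp: leg1_def leg2_def Hom_def)

lemma rel_Hom:
  assumes "is_relation C X m" "rel m T a b"
  shows "a \<in> Hom C T X" "b \<in> Hom C T X"
  using assms is_relation_Hom[OF assms(1)] Hom_comp unfolding rel_def by blast+

lemma legs_jointly_monic:
  assumes "is_relation C X m" "h \<in> Hom C T (Dom C m)" "k \<in> Hom C T (Dom C m)"
    "leg1 C X m \<cdot> h = leg1 C X m \<cdot> k" "leg2 C X m \<cdot> h = leg2 C X m \<cdot> k"
  shows "h = k"
proof (rule monicD[of m, OF _ _ assms(2,3)])
  show "monic C m"
    using assms(1) by (simp add: is_relation_def)
  show "m \<cdot> h = m \<cdot> k"
    by (rule pair_eqI[of _ T])
      (use assms leg_comp[OF assms(1)] is_relation_Hom(1)[OF assms(1)] in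
        \<open>auto simp del: comp_assoc intro: Hom_comp\<close>)
qed

lemma rel_comp:
  assumes "is_relation C X m" "rel m T a b" "e \<in> Hom C T' T"
  shows "rel m T' (a \<cdot> e) (b \<cdot> e)"
proof -
  obtain k where k: "k \<in> Hom C T (Dom C m)" "leg1 C X m \<cdot> k = a" "leg2 C X m \<cdot> k = b"
    using assms(2) by (auto simp: rel_def)
  then show ?thesis
    using comp_comp_eq[OF k(2) assms(3) k(1)] comp_comp_eq[OF k(3) assms(3) k(1)]
      is_relation_Hom[OF assms(1)] Hom_comp[OF assms(3) k(1)] unfolding rel_def by metis
qed

text \<open>The pair is a single map \<open>h\<close> into the square. After the cover it factors
  through the monic \<open>m\<close>, and the diagonal filler factors \<open>h\<close>
  itself.\<close>

lemma rel_local: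
  assumes "is_relation C X m" "a \<in> Hom C T X" "b \<in> Hom C T X" "e \<in> Cover T' T"
    "rel m T' (a \<cdot> e) (b \<cdot> e)"
  shows "rel m T a b"
proof -
  note eH = CoverD(1)[OF assms(4)]
  note mH = is_relation_Hom[OF assms(1)]
  obtain k where k: "k \<in> Hom C T' (Dom C m)" "leg1 C X m \<cdot> k = a \<cdot> e" "leg2 C X m \<cdot> k = b \<cdot> e"
    using assms(5) by (auto simp: rel_def)
  obtain h where h: "h \<in> Hom C T (square_obj C X)" "proj1 C X \<cdot> h = a" "proj2 C X \<cdot> h = b"
    using pair_exists[OF assms(2,3)] by blast
  have "m \<cdot> k = h \<cdot> e"
  proof (rule pair_eqI)
    show "m \<cdot> k \<in> Hom C T' (square_obj C X)" "h \<cdot> e \<in> Hom C T' (square_obj C X)"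
      using Hom_comp[OF k(1) mH(1)] Hom_comp[OF eH h(1)] .
    show "proj1 C X \<cdot> m \<cdot> k = proj1 C X \<cdot> h \<cdot> e" "proj2 C X \<cdot> m \<cdot> k = proj2 C X \<cdot> h \<cdot> e"
      using leg_comp[OF assms(1) k(1)] k comp_comp_eq[OF h(2) eH h(1)] comp_comp_eq[OF h(3) eH h(1)]
        proj_Hom by auto
  qed
  then obtain d where d: "d \<in> Hom C T (Dom C m)" "m \<cdot> d = h"
    using regular_epi_diagonal[OF CoverD(2)[OF assms(4)] eH, of m k h] assms(1) k h
    by (auto simp: is_relation_def)
  then show ?thesis
    using leg_comp[OF assms(1) d(1)] h by (auto simp: rel_def)
qed

lemma rel_legs:
  assumes "is_relation C X m"
  shows "k \<in> Hom C T (Dom C m) \<Longrightarrow> rel m T (leg1 C X m \<cdot> k) (leg2 C X m \<cdot> k)"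
    "rel m (Dom C m) (leg1 C X m) (leg2 C X m)"
proof -
  note mH = is_relation_Hom[OF assms]
  show "rel m (Dom C m) (leg1 C X m) (leg2 C X m)"
    unfolding rel_def using Ident_closed[OF Hom_Obj(1)[OF mH(1)]] mH(2,3) Comp_Ident by blast
qed (auto simp: rel_def)

text \<open>Yoneda: the implication from right to left is evaluated at the generic related pair, the
  two legs of \<open>m\<close> over \<open>Dom C m\<close>.\<close>

lemma subobject_le_iff:
  assumes "is_relation C X m" "is_relation C X n"
  shows "subobject_le C m n \<longleftrightarrow> (\<forall>T a b. rel m T a b \<longrightarrow> rel n T a b)"
proof
  assume "subobject_le C m n"
  then obtain k where k: "k \<in> Hom C (Dom C m) (Dom C n)" "n \<cdot> k = m"
    by (auto simp: subobject_le_def)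
  have legs: "leg1 C X n \<cdot> k = leg1 C X m" "leg2 C X n \<cdot> k = leg2 C X m"
    using leg_comp[OF assms(2) k(1)] k(2) by (auto simp: leg1_def leg2_def)
  show "\<forall>T a b. rel m T a b \<longrightarrow> rel n T a b"
  proof (intro allI impI)
    fix T a b assume "rel m T a b"
    then obtain j where j: "j \<in> Hom C T (Dom C m)" "leg1 C X m \<cdot> j = a" "leg2 C X m \<cdot> j = b"
      by (auto simp: rel_def)
    then show "rel n T a b"
      using comp_comp_eq[OF legs(1) j(1) k(1)] comp_comp_eq[OF legs(2) j(1) k(1)]
        is_relation_Hom[OF assms(2)] Hom_comp[OF j(1) k(1)] unfolding rel_def by metis
  qed
next
  assume le: "\<forall>T a b. rel m T a b \<longrightarrow> rel n T a b"
  note mH = is_relation_Hom[OF assms(1)]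
  have "rel n (Dom C m) (leg1 C X m) (leg2 C X m)"
    using le rel_legs(2)[OF assms(1)] by blast
  then obtain k where k: "k \<in> Hom C (Dom C m) (Dom C n)"
      "leg1 C X n \<cdot> k = leg1 C X m" "leg2 C X n \<cdot> k = leg2 C X m"
    by (auto simp: rel_def)
  have "m = n \<cdot> k"
    by (rule pair_eqI[OF mH(1) Hom_comp[OF k(1) is_relation_Hom(1)[OF assms(2)]]])
      (use k leg_comp[OF assms(2) k(1)] in \<open>simp_all add: leg1_def leg2_def\<close>)
  with k show "subobject_le C m n"
    by (auto simp: subobject_le_def)
qed

text \<open>Yoneda once more, with the identity of \<open>X\<close> as the generic element; symmetry
  below uses the generic related pair.\<close>

lemma reflexive_relation_iff:
  assumes "is_relation C X m"
  shows "reflexive_relation C X m \<longleftrightarrow> (\<forall>T. \<forall>a \<in> Hom C T X. rel m T a a)"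
proof
  assume "reflexive_relation C X m"
  then have id: "rel m X (Ident C X) (Ident C X)"
    by (auto simp: reflexive_relation_def rel_def)
  show "\<forall>T. \<forall>a \<in> Hom C T X. rel m T a a"
  proof (intro allI ballI)
    fix T a assume a: "a \<in> Hom C T X"
    show "rel m T a a"
      using rel_comp[OF assms id a] a by (auto simp: Hom_def)
  qed
next
  assume "\<forall>T. \<forall>a \<in> Hom C T X. rel m T a a"
  then have "rel m X (Ident C X) (Ident C X)"
    using Ident_closed[OF X] by blast
  then show "reflexive_relation C X m"
    using assms by (auto simp: reflexive_relation_def rel_def)
qed

lemma symmetric_relation_iff:
  assumes "is_relation C X m"
  shows "symmetric_relation C X m \<longleftrightarrow> (\<forall>T a b. rel m T a b \<longrightarrow> rel m T b a)"
proof
  note mH = is_relation_Hom[OF assms]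
  assume "symmetric_relation C X m"
  then obtain s where s: "s \<in> Hom C (Dom C m) (Dom C m)"
      "leg1 C X m \<cdot> s = leg2 C X m" "leg2 C X m \<cdot> s = leg1 C X m"
    by (auto simp: symmetric_relation_def)
  show "\<forall>T a b. rel m T a b \<longrightarrow> rel m T b a"
  proof (intro allI impI)
    fix T a b assume "rel m T a b"
    then obtain k where k: "k \<in> Hom C T (Dom C m)" "leg1 C X m \<cdot> k = a" "leg2 C X m \<cdot> k = b"
      by (auto simp: rel_def)
    then show "rel m T b a"
      using comp_comp_eq[OF s(2) k(1) s(1)] comp_comp_eq[OF s(3) k(1) s(1)] mH
        Hom_comp[OF k(1) s(1)] unfolding rel_def by metis
  qed
next
  assume "\<forall>T a b. rel m T a b \<longrightarrow> rel m T b a"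
  then have "rel m (Dom C m) (leg2 C X m) (leg1 C X m)"
    using rel_legs[OF assms] by blast
  then show "symmetric_relation C X m"
    using assms by (auto simp: symmetric_relation_def rel_def)
qed

text \<open>A pullback of the legs carries the generic composable pair. The definition quantifies
  over all pullbacks: one direction picks one of them, and the other evaluates the elementwise
  condition at an arbitrary one.\<close>

lemma transitive_relation_iff:
  assumes "is_relation C X m"
  shows "transitive_relation C X m \<longleftrightarrow>
    (\<forall>T a b c. rel m T a b \<longrightarrow> rel m T b c \<longrightarrow> rel m T a c)"
proof
  note mH = is_relation_Hom[OF assms]
  assume trans: "transitive_relation C X m"
  obtain P p q where P: "is_pullback C (leg2 C X m) (leg1 C X m) P p q"
    using pullback_exists[OF finitely_complete mH(3,2)] by blast
  then have pq: "p \<in> Hom C P (Dom C m)" "q \<in> Hom C P (Dom C m)"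
    using mH by (auto simp: is_pullback_def Hom_def)
  obtain t where t: "t \<in> Hom C P (Dom C m)" "leg1 C X m \<cdot> t = leg1 C X m \<cdot> p"
      "leg2 C X m \<cdot> t = leg2 C X m \<cdot> q"
    using trans P unfolding transitive_relation_def by blast
  show "\<forall>T a b c. rel m T a b \<longrightarrow> rel m T b c \<longrightarrow> rel m T a c"
  proof (intro allI impI)
    fix T a b c assume "rel m T a b" "rel m T b c"
    then obtain k l where k: "k \<in> Hom C T (Dom C m)" "leg1 C X m \<cdot> k = a" "leg2 C X m \<cdot> k = b"
      and l: "l \<in> Hom C T (Dom C m)" "leg1 C X m \<cdot> l = b" "leg2 C X m \<cdot> l = c"
      by (auto simp: rel_def)
    then obtain h where h: "h \<in> Hom C T P" "p \<cdot> h = k" "q \<cdot> h = l"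
      using pullback_lift[OF P mH(3,2) k(1) l(1)] by auto
    have "leg1 C X m \<cdot> (t \<cdot> h) = a" "leg2 C X m \<cdot> (t \<cdot> h) = c"
      using comp_comp_eq[OF t(2) h(1) t(1) mH(2)] comp_comp_eq[OF t(3) h(1) t(1) mH(3)] h k l
        comp_comp_eq[OF refl h(1) pq(1) mH(2)] comp_comp_eq[OF refl h(1) pq(2) mH(3)] by simp_all
    then show "rel m T a c"
      using Hom_comp[OF h(1) t(1)] by (auto simp: rel_def)
  qed
next
  note mH = is_relation_Hom[OF assms]
  assume trans: "\<forall>T a b c. rel m T a b \<longrightarrow> rel m T b c \<longrightarrow> rel m T a c"
  have "\<exists>t \<in> Hom C T (Dom C m). leg1 C X m \<cdot> t = leg1 C X m \<cdot> a \<and> leg2 C X m \<cdot> t = leg2 C X m \<cdot> b"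
    if P: "is_pullback C (leg2 C X m) (leg1 C X m) T a b" for T a b
  proof -
    have "a \<in> Hom C T (Dom C m)" "b \<in> Hom C T (Dom C m)" "leg2 C X m \<cdot> a = leg1 C X m \<cdot> b"
      using pullback_Hom[OF P mH(3,2)] .
    then have "rel m T (leg1 C X m \<cdot> a) (leg2 C X m \<cdot> b)"
      using trans rel_legs(1)[OF assms] by metis
    then show ?thesis
      by (auto simp: rel_def)
  qed
  then show "transitive_relation C X m"
    using assms by (auto simp: transitive_relation_def)
qed

section \<open>Jointly monic pairs, images, intersections, composites and kernel pairs as
  relations\<close>

lemma relation_of_pair:
  assumes "f \<in> Hom C K X" "g \<in> Hom C K X"
    "\<And>T a b. a \<in> Hom C T K \<Longrightarrow> b \<in> Hom C T K \<Longrightarrow> f \<cdot> a = f \<cdot> b \<Longrightarrow> g \<cdot> a = g \<cdot> b \<Longrightarrow> a = b"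
  shows "\<exists>m. is_relation C X m \<and> Dom C m = K \<and> leg1 C X m = f \<and> leg2 C X m = g"
proof -
  obtain m where m: "m \<in> Hom C K (square_obj C X)" "proj1 C X \<cdot> m = f" "proj2 C X \<cdot> m = g"
    using pair_exists[OF assms(1,2)] by blast
  have "monic C m"
    unfolding monic_def
  proof (intro conjI allI ballI impI)
    show "m \<in> Mor C"
      using m by (auto simp: Hom_def)
    fix T a b assume "a \<in> Hom C T (Dom C m)" "b \<in> Hom C T (Dom C m)" and eq: "m \<cdot> a = m \<cdot> b"
    then have ab: "a \<in> Hom C T K" "b \<in> Hom C T K"
      using m by (auto simp: Hom_def)
    show "a = b"
      using comp_comp_eq[OF m(2) ab(1) m(1) proj_Hom(1)] comp_comp_eq[OF m(2) ab(2) m(1) proj_Hom(1)]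
        comp_comp_eq[OF m(3) ab(1) m(1) proj_Hom(2)] comp_comp_eq[OF m(3) ab(2) m(1) proj_Hom(2)] eq
      by (intro assms(3)[OF ab]) simp_all
  qed
  then show ?thesis
    using m by (auto simp: is_relation_def leg1_def leg2_def Hom_def)
qed

text \<open>The relation is the monic part of the map from \<open>K\<close> to the square. Elements
  of an image come from \<open>K\<close> only after a cover, and conversely what comes from
  \<open>K\<close> locally is in the image by descent.\<close>

lemma image_relation:
  assumes "f \<in> Hom C K X" "g \<in> Hom C K X"
  shows "\<exists>m. is_relation C X m \<and> (\<forall>T. \<forall>a \<in> Hom C T X. \<forall>b \<in> Hom C T X.
    rel m T a b \<longleftrightarrow> (\<exists>T' e k. e \<in> Cover T' T \<and> k \<in> Hom C T' K \<and> f \<cdot> k = a \<cdot> e \<and> g \<cdot> k = b \<cdot> e))"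
proof -
  obtain h where h: "h \<in> Hom C K (square_obj C X)" "proj1 C X \<cdot> h = f" "proj2 C X \<cdot> h = g"
    using pair_exists[OF assms] by blast
  obtain I q m where q: "q \<in> Cover K I" and m: "monic C m" "m \<in> Hom C I (square_obj C X)" "h = m \<cdot> q"
    using regular_mono_factorization[OF h(1)] by blast
  note qH = CoverD(1)[OF q]
  have rel: "is_relation C X m" and dom: "Dom C m = I"
    using m by (auto simp: is_relation_def Hom_def)
  note mH = is_relation_Hom[OF rel]
  have legs: "leg1 C X m \<cdot> q = f" "leg2 C X m \<cdot> q = g"
    using leg_comp[OF rel, of q] qH dom h m by auto
  have "rel m T a b \<longleftrightarrow> (\<exists>T' e k. e \<in> Cover T' T \<and> k \<in> Hom C T' K \<and> f \<cdot> k = a \<cdot> e \<and> g \<cdot> k = b \<cdot> e)"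
    if ab: "a \<in> Hom C T X" "b \<in> Hom C T X" for T a b
  proof
    assume "rel m T a b"
    then obtain j where j: "j \<in> Hom C T I" "leg1 C X m \<cdot> j = a" "leg2 C X m \<cdot> j = b"
      using dom by (auto simp: rel_def)
    obtain T' e k where e: "e \<in> Cover T' T" "k \<in> Hom C T' K" "q \<cdot> k = j \<cdot> e"
      using Cover_lift[OF q j(1)] by blast
    note eH = CoverD(1)[OF e(1)]
    have "f \<cdot> k = a \<cdot> e" "g \<cdot> k = b \<cdot> e"
      using comp_comp_eq[OF legs(1) e(2) qH] comp_comp_eq[OF legs(2) e(2) qH] mH dom e
        comp_comp_eq[OF j(2) eH j(1)] comp_comp_eq[OF j(3) eH j(1)] by auto
    with e show "\<exists>T' e k. e \<in> Cover T' T \<and> k \<in> Hom C T' K \<and> f \<cdot> k = a \<cdot> e \<and> g \<cdot> k = b \<cdot> e"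
      by blast
  next
    assume "\<exists>T' e k. e \<in> Cover T' T \<and> k \<in> Hom C T' K \<and> f \<cdot> k = a \<cdot> e \<and> g \<cdot> k = b \<cdot> e"
    then obtain T' e k where e: "e \<in> Cover T' T" "k \<in> Hom C T' K" "f \<cdot> k = a \<cdot> e" "g \<cdot> k = b \<cdot> e"
      by blast
    have "rel m T' (f \<cdot> k) (g \<cdot> k)"
      using comp_comp_eq[OF legs(1) e(2) qH] comp_comp_eq[OF legs(2) e(2) qH] mH dom
        Hom_comp[OF e(2) qH] by (auto simp: rel_def)
    then show "rel m T a b"
      using rel_local[OF rel ab e(1)] e by simp
  qed
  with rel show ?thesis
    by blast
qed

text \<open>The pullback of the two subobjects of the square; its legs can be read through
  \<open>m\<close> or through \<open>n\<close>, and an element of it is a pair lying in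
  both.\<close>

lemma intersection_relation:
  assumes "is_relation C X m" "is_relation C X n"
  shows "\<exists>c. is_relation C X c \<and> (\<forall>T a b. rel c T a b \<longleftrightarrow> rel m T a b \<and> rel n T a b)"
proof -
  note mH = is_relation_Hom[OF assms(1)] and nH = is_relation_Hom[OF assms(2)]
  obtain P p q where P: "is_pullback C m n P p q"
    using pullback_exists[OF finitely_complete mH(1) nH(1)] by blast
  note pq = pullback_Hom[OF P mH(1) nH(1)]
  have legs: "leg1 C X m \<cdot> (p \<cdot> k) = leg1 C X n \<cdot> (q \<cdot> k)"
      "leg2 C X m \<cdot> (p \<cdot> k) = leg2 C X n \<cdot> (q \<cdot> k)" if k: "k \<in> Hom C T P" for T k
    using leg_comp[OF assms(1) Hom_comp[OF k pq(1)]] leg_comp[OF assms(2) Hom_comp[OF k pq(2)]]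
      comp_comp_eq[OF pq(3) k pq(1) mH(1)] comp_comp_eq[OF refl k pq(2) nH(1)] by simp_all
  have leg_assoc: "(leg1 C X m \<cdot> p) \<cdot> k = leg1 C X m \<cdot> (p \<cdot> k)"
      "(leg2 C X m \<cdot> p) \<cdot> k = leg2 C X m \<cdot> (p \<cdot> k)" if k: "k \<in> Hom C T P" for T k
    using comp_comp_eq[OF refl k pq(1) mH(2)] comp_comp_eq[OF refl k pq(1) mH(3)] by simp_all
  have "\<exists>c. is_relation C X c \<and> Dom C c = P \<and> leg1 C X c = leg1 C X m \<cdot> p \<and> leg2 C X c = leg2 C X m \<cdot> p"
  proof (rule relation_of_pair[OF Hom_comp[OF pq(1) mH(2)] Hom_comp[OF pq(1) mH(3)]])
    fix T a b assume ab: "a \<in> Hom C T P" "b \<in> Hom C T P"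
      and eq: "(leg1 C X m \<cdot> p) \<cdot> a = (leg1 C X m \<cdot> p) \<cdot> b" "(leg2 C X m \<cdot> p) \<cdot> a = (leg2 C X m \<cdot> p) \<cdot> b"
    have "leg1 C X m \<cdot> (p \<cdot> a) = leg1 C X m \<cdot> (p \<cdot> b)" "leg2 C X m \<cdot> (p \<cdot> a) = leg2 C X m \<cdot> (p \<cdot> b)"
      using eq leg_assoc[OF ab(1)] leg_assoc[OF ab(2)] by simp_all
    then show "a = b"
      using legs[OF ab(1)] legs[OF ab(2)] legs_jointly_monic[OF assms(1) ab[THEN Hom_comp[OF _ pq(1)]]]
        legs_jointly_monic[OF assms(2) ab[THEN Hom_comp[OF _ pq(2)]]]
      by (intro pullback_eqI[OF P mH(1) nH(1) ab]) simp_all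
  qed
  then obtain c where c: "is_relation C X c" "Dom C c = P" "leg1 C X c = leg1 C X m \<cdot> p"
      "leg2 C X c = leg2 C X m \<cdot> p"
    by blast
  have "rel c T a b \<longleftrightarrow> rel m T a b \<and> rel n T a b" for T a b
  proof
    assume "rel c T a b"
    then obtain k where k: "k \<in> Hom C T P" "leg1 C X m \<cdot> (p \<cdot> k) = a" "leg2 C X m \<cdot> (p \<cdot> k) = b"
      using c leg_assoc unfolding rel_def by metis
    then show "rel m T a b \<and> rel n T a b"
      using legs[OF k(1)] Hom_comp[OF k(1) pq(1)] Hom_comp[OF k(1) pq(2)] unfolding rel_def by metis
  next
    assume "rel m T a b \<and> rel n T a b"
    then obtain k l where k: "k \<in> Hom C T (Dom C m)" "leg1 C X m \<cdot> k = a" "leg2 C X m \<cdot> k = b"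
      and l: "l \<in> Hom C T (Dom C n)" "leg1 C X n \<cdot> l = a" "leg2 C X n \<cdot> l = b"
      by (auto simp: rel_def)
    have "m \<cdot> k = n \<cdot> l"
      using leg_comp[OF assms(1) k(1)] leg_comp[OF assms(2) l(1)] k l
      by (intro pair_eqI[OF Hom_comp[OF k(1) mH(1)] Hom_comp[OF l(1) nH(1)]]) simp_all
    then obtain h where h: "h \<in> Hom C T P" "p \<cdot> h = k"
      using pullback_lift[OF P mH(1) nH(1) k(1) l(1)] by blast
    then have "leg1 C X c \<cdot> h = a" "leg2 C X c \<cdot> h = b"
      using c leg_assoc[OF h(1)] k by simp_all
    with h(1) c(2) show "rel c T a b"
      by (auto simp: rel_def)
  qed
  with c(1) show ?thesis
    by blast
qed

text \<open>Relational composition, with \<open>m\<close> applied first. The middle element exists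
  only locally since the composite is an image. The typing of \<open>a\<close> and \<open>b\<close>
  is demanded separately because membership of \<open>a \<cdot> e\<close> and
  \<open>b \<cdot> e\<close> does not type \<open>a\<close> and \<open>b\<close> themselves.\<close>

definition rcomp :: "'m \<Rightarrow> 'm \<Rightarrow> 'o \<Rightarrow> 'm \<Rightarrow> 'm \<Rightarrow> bool" where
  "rcomp m n T a b \<longleftrightarrow> a \<in> Hom C T X \<and> b \<in> Hom C T X \<and>
    (\<exists>T' e y. e \<in> Cover T' T \<and> rel m T' (a \<cdot> e) y \<and> rel n T' y (b \<cdot> e))"

lemma composite_relation:
  assumes "is_relation C X m" "is_relation C X n"
  shows "\<exists>c. is_relation C X c \<and> (\<forall>T a b. rel c T a b \<longleftrightarrow> rcomp m n T a b)"
proof -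
  note mH = is_relation_Hom[OF assms(1)] and nH = is_relation_Hom[OF assms(2)]
  obtain P p q where P: "is_pullback C (leg2 C X m) (leg1 C X n) P p q"
    using pullback_exists[OF finitely_complete mH(3) nH(2)] by blast
  note pq = pullback_Hom[OF P mH(3) nH(2)]
  let ?f = "leg1 C X m \<cdot> p" and ?g = "leg2 C X n \<cdot> q"
  have assoc: "?f \<cdot> k = leg1 C X m \<cdot> (p \<cdot> k)" "?g \<cdot> k = leg2 C X n \<cdot> (q \<cdot> k)" if "k \<in> Hom C T P" for T k
    using comp_comp_eq[OF refl that pq(1) mH(2)] comp_comp_eq[OF refl that pq(2) nH(3)] by simp_all
  have middle: "leg2 C X m \<cdot> (p \<cdot> k) = leg1 C X n \<cdot> (q \<cdot> k)" if "k \<in> Hom C T P" for T k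
    using comp_comp_eq[OF pq(3) that pq(1) mH(3)] comp_comp_eq[OF refl that pq(2) nH(2)] by simp
  obtain c where c: "is_relation C X c"
    and rel_c: "\<And>T a b. a \<in> Hom C T X \<Longrightarrow> b \<in> Hom C T X \<Longrightarrow> rel c T a b \<longleftrightarrow>
      (\<exists>T' e k. e \<in> Cover T' T \<and> k \<in> Hom C T' P \<and> ?f \<cdot> k = a \<cdot> e \<and> ?g \<cdot> k = b \<cdot> e)"
    using image_relation[OF Hom_comp[OF pq(1) mH(2)] Hom_comp[OF pq(2) nH(3)]] by blast
  \<comment> \<open>Elements of the pullback \<open>P\<close> are the composable pairs, so
    forgetting the middle element and then taking the image gives the composite.\<close>
  have step: "(\<exists>k \<in> Hom C T P. ?f \<cdot> k = a \<and> ?g \<cdot> k = b) \<longleftrightarrow> (\<exists>y. rel m T a y \<and> rel n T y b)" for T a b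
  proof
    assume "\<exists>k \<in> Hom C T P. ?f \<cdot> k = a \<and> ?g \<cdot> k = b"
    then obtain k where k: "k \<in> Hom C T P" "leg1 C X m \<cdot> (p \<cdot> k) = a" "leg2 C X n \<cdot> (q \<cdot> k) = b"
      using assoc by metis
    have "rel m T a (leg2 C X m \<cdot> (p \<cdot> k))"
      using rel_legs(1)[OF assms(1) Hom_comp[OF k(1) pq(1)]] k by simp
    moreover have "rel n T (leg2 C X m \<cdot> (p \<cdot> k)) b"
      using rel_legs(1)[OF assms(2) Hom_comp[OF k(1) pq(2)]] k middle[OF k(1)] by simp
    ultimately show "\<exists>y. rel m T a y \<and> rel n T y b"
      by blast
  next
    assume "\<exists>y. rel m T a y \<and> rel n T y b"
    then obtain y k l where k: "k \<in> Hom C T (Dom C m)" "leg1 C X m \<cdot> k = a" "leg2 C X m \<cdot> k = y"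
      and l: "l \<in> Hom C T (Dom C n)" "leg1 C X n \<cdot> l = y" "leg2 C X n \<cdot> l = b"
      by (auto simp: rel_def)
    obtain h where h: "h \<in> Hom C T P" "p \<cdot> h = k" "q \<cdot> h = l"
      using pullback_lift[OF P mH(3) nH(2) k(1) l(1)] k l by auto
    then show "\<exists>k \<in> Hom C T P. ?f \<cdot> k = a \<and> ?g \<cdot> k = b"
      using assoc[OF h(1)] k l by auto
  qed
  have "rel c T a b \<longleftrightarrow> rcomp m n T a b" for T a b
  proof (cases "a \<in> Hom C T X \<and> b \<in> Hom C T X")
    case True
    then have "rel c T a b \<longleftrightarrow>
        (\<exists>T' e. e \<in> Cover T' T \<and> (\<exists>k \<in> Hom C T' P. ?f \<cdot> k = a \<cdot> e \<and> ?g \<cdot> k = b \<cdot> e))"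
      using rel_c by blast
    with True show ?thesis
      unfolding step rcomp_def by blast
  next
    case False
    then show ?thesis
      using rel_Hom[OF c] unfolding rcomp_def by blast
  qed
  with c show ?thesis
    by blast
qed

text \<open>Legs of a relation are jointly monic, which is the uniqueness half of the universal
  property; the condition on \<open>rel\<close> supplies commutativity and existence.\<close>

lemma kernel_pair_iff:
  assumes "is_relation C X m" "q \<in> Hom C X D"
  shows "is_kernel_pair C q (Dom C m) (leg1 C X m) (leg2 C X m) \<longleftrightarrow>
    (\<forall>T a b. rel m T a b \<longleftrightarrow> a \<in> Hom C T X \<and> b \<in> Hom C T X \<and> q \<cdot> a = q \<cdot> b)"
proof
  note mH = is_relation_Hom[OF assms(1)]
  assume "is_kernel_pair C q (Dom C m) (leg1 C X m) (leg2 C X m)"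
  then have P: "is_pullback C q q (Dom C m) (leg1 C X m) (leg2 C X m)"
    by (simp add: is_kernel_pair_def)
  note legs = pullback_Hom[OF P assms(2,2)]
  show "\<forall>T a b. rel m T a b \<longleftrightarrow> a \<in> Hom C T X \<and> b \<in> Hom C T X \<and> q \<cdot> a = q \<cdot> b"
  proof (intro allI iffI)
    fix T a b assume ab: "rel m T a b"
    then obtain k where "k \<in> Hom C T (Dom C m)" "leg1 C X m \<cdot> k = a" "leg2 C X m \<cdot> k = b"
      by (auto simp: rel_def)
    then show "a \<in> Hom C T X \<and> b \<in> Hom C T X \<and> q \<cdot> a = q \<cdot> b"
      using rel_Hom[OF assms(1) ab] comp_comp_eq[OF legs(3) _ mH(2) assms(2)]
        comp_comp_eq[OF refl _ mH(3) assms(2)] by metis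
  next
    fix T a b assume "a \<in> Hom C T X \<and> b \<in> Hom C T X \<and> q \<cdot> a = q \<cdot> b"
    then show "rel m T a b"
      using pullback_lift[OF P assms(2,2)] by (simp add: rel_def)
  qed
next
  note mH = is_relation_Hom[OF assms(1)]
  assume ker: "\<forall>T a b. rel m T a b \<longleftrightarrow> a \<in> Hom C T X \<and> b \<in> Hom C T X \<and> q \<cdot> a = q \<cdot> b"
  have q: "q \<in> Mor C" "Dom C q = X"
    using assms(2) by (auto simp: Hom_def)
  have "\<exists>!h. h \<in> Hom C T (Dom C m) \<and> leg1 C X m \<cdot> h = a \<and> leg2 C X m \<cdot> h = b"
    if "a \<in> Hom C T X" "b \<in> Hom C T X" "q \<cdot> a = q \<cdot> b" for T a b
  proof -
    have "rel m T a b"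
      using ker that by blast
    then obtain h where "h \<in> Hom C T (Dom C m)" "leg1 C X m \<cdot> h = a" "leg2 C X m \<cdot> h = b"
      by (auto simp: rel_def)
    then show ?thesis
      using legs_jointly_monic[OF assms(1)] by (intro ex1I[of _ h]) auto
  qed
  then show "is_kernel_pair C q (Dom C m) (leg1 C X m) (leg2 C X m)"
    using ker rel_legs(2)[OF assms(1)] mH q unfolding is_kernel_pair_def is_pullback_def q(2) by blast
qed

lemma kernel_relation:
  assumes "q \<in> Hom C X D"
  shows "\<exists>m. is_relation C X m \<and>
    (\<forall>T a b. rel m T a b \<longleftrightarrow> a \<in> Hom C T X \<and> b \<in> Hom C T X \<and> q \<cdot> a = q \<cdot> b)"
proof -
  obtain K k l where P: "is_pullback C q q K k l"
    using pullback_exists[OF finitely_complete assms assms] by blast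
  note kl = pullback_Hom[OF P assms assms]
  obtain m where m: "is_relation C X m" "Dom C m = K" "leg1 C X m = k" "leg2 C X m = l"
    using relation_of_pair[OF kl(1,2)] pullback_eqI[OF P assms assms] by blast
  then have "is_kernel_pair C q (Dom C m) (leg1 C X m) (leg2 C X m)"
    using P by (simp add: is_kernel_pair_def)
  then show ?thesis
    using kernel_pair_iff[OF m(1) assms] m(1) by blast
qed

lemma equivalence_relation_iff:
  "equivalence_relation C X m \<longleftrightarrow> is_relation C X m \<and> (\<forall>T. \<forall>a \<in> Hom C T X. rel m T a a) \<and>
    (\<forall>T a b. rel m T a b \<longrightarrow> rel m T b a) \<and>
    (\<forall>T a b c. rel m T a b \<longrightarrow> rel m T b c \<longrightarrow> rel m T a c)"
proof (cases "is_relation C X m")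
  case True
  then show ?thesis
    unfolding equivalence_relation_def reflexive_relation_iff[OF True] symmetric_relation_iff[OF True]
      transitive_relation_iff[OF True] by (simp only: simp_thms)
next
  case False
  then show ?thesis
    by (simp add: equivalence_relation_def reflexive_relation_def)
qed

lemma equivalence_relationD:
  assumes "equivalence_relation C X m"
  shows "is_relation C X m" "a \<in> Hom C T X \<Longrightarrow> rel m T a a" "rel m T a b \<Longrightarrow> rel m T b a"
    "rel m T a b \<Longrightarrow> rel m T b c \<Longrightarrow> rel m T a c"
  using assms unfolding equivalence_relation_iff by blast+

lemma kernel_equivalence:
  assumes "q \<in> Hom C X D"
  shows "\<exists>m. equivalence_relation C X m \<and>
    (\<forall>T a b. rel m T a b \<longleftrightarrow> a \<in> Hom C T X \<and> b \<in> Hom C T X \<and> q \<cdot> a = q \<cdot> b)"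
proof -
  obtain m where m: "is_relation C X m"
    "\<And>T a b. rel m T a b \<longleftrightarrow> a \<in> Hom C T X \<and> b \<in> Hom C T X \<and> q \<cdot> a = q \<cdot> b"
    using kernel_relation[OF assms] by blast
  then have "equivalence_relation C X m"
    unfolding equivalence_relation_iff m(2) by simp
  with m(2) show ?thesis
    by blast
qed

lemma equivalence_intersection:
  assumes "equivalence_relation C X m" "equivalence_relation C X n"
  shows "\<exists>c. equivalence_relation C X c \<and> (\<forall>T a b. rel c T a b \<longleftrightarrow> rel m T a b \<and> rel n T a b)"
proof -
  obtain c where c: "is_relation C X c" "\<And>T a b. rel c T a b \<longleftrightarrow> rel m T a b \<and> rel n T a b"
    using intersection_relation assms[THEN equivalence_relationD(1)] by blast
  have "equivalence_relation C X c"
    using assms c(1) unfolding equivalence_relation_iff c(2) by blast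
  with c(2) show ?thesis
    by blast
qed

text \<open>Reflexivity of \<open>n\<close> makes \<open>b\<close> the middle element over the
  identity cover. With \<open>rcomp_right\<close> and \<open>rcomp_least\<close> it shows that the
  composite is the join as soon as it is an equivalence relation.\<close>

lemma rcomp_left:
  assumes "is_relation C X m" "equivalence_relation C X n" "rel m T a b"
  shows "rcomp m n T a b"
proof -
  note H = rel_Hom[OF assms(1,3)]
  have "a \<cdot> Ident C T = a" "b \<cdot> Ident C T = b" "T \<in> Obj C"
    using H Hom_Obj[OF H(1)] by (auto simp: Hom_def)
  then show ?thesis
    using H assms Cover_Ident equivalence_relationD(2)[OF assms(2)] unfolding rcomp_def by metis
qed

lemma rcomp_right:
  assumes "equivalence_relation C X m" "is_relation C X n" "rel n T a b"
  shows "rcomp m n T a b"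
proof -
  note H = rel_Hom[OF assms(2,3)]
  have "a \<cdot> Ident C T = a" "b \<cdot> Ident C T = b" "T \<in> Obj C"
    using H Hom_Obj[OF H(1)] by (auto simp: Hom_def)
  then show ?thesis
    using H assms Cover_Ident equivalence_relationD(2)[OF assms(1)] unfolding rcomp_def by metis
qed

text \<open>Transitivity of \<open>k\<close> removes the middle element, and descent removes the
  cover.\<close>

lemma rcomp_least:
  assumes "equivalence_relation C X k" "\<And>T a b. rel m T a b \<Longrightarrow> rel k T a b"
    "\<And>T a b. rel n T a b \<Longrightarrow> rel k T a b" "rcomp m n T a b"
  shows "rel k T a b"
proof -
  obtain T' e y where e: "a \<in> Hom C T X" "b \<in> Hom C T X" "e \<in> Cover T' T" "rel m T' (a \<cdot> e) y"
      "rel n T' y (b \<cdot> e)"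
    using assms(4) by (auto simp: rcomp_def)
  then have "rel k T' (a \<cdot> e) (b \<cdot> e)"
    using assms(2,3) equivalence_relationD(4)[OF assms(1)] by blast
  then show ?thesis
    using rel_local[OF equivalence_relationD(1)[OF assms(1)] e(1-3)] by blast
qed

lemma subobject_le_equiv_iff:
  assumes "equivalence_relation C X m" "equivalence_relation C X n"
  shows "subobject_le C m n \<longleftrightarrow> (\<forall>T a b. rel m T a b \<longrightarrow> rel n T a b)"
  using subobject_le_iff assms[THEN equivalence_relationD(1)] .

end


section \<open>The lattice of equivalence relations in a Mal'tsev category\<close>

locale maltsev_object = regular_object +
  assumes maltsev: "maltsev_category C"
begin

text \<open>The composite contains \<open>m\<close>, hence is reflexive; the Mal'tsev property
  supplies symmetry and transitivity.\<close>

lemma equivalence_composite: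
  assumes "equivalence_relation C X m" "equivalence_relation C X n"
  shows "\<exists>c. equivalence_relation C X c \<and> (\<forall>T a b. rel c T a b \<longleftrightarrow> rcomp m n T a b)"
proof -
  obtain c where c: "is_relation C X c" "\<And>T a b. rel c T a b \<longleftrightarrow> rcomp m n T a b"
    using composite_relation assms[THEN equivalence_relationD(1)] by blast
  have "reflexive_relation C X c"
    unfolding reflexive_relation_iff[OF c(1)] c(2)
    using rcomp_left[OF equivalence_relationD(1)[OF assms(1)] assms(2)] equivalence_relationD(2)[OF assms(1)]
    by blast
  then have "equivalence_relation C X c"
    using maltsev X unfolding maltsev_category_def by blast
  with c(2) show ?thesis
    by blast
qed

section \<open>The order and the lattice operations of \<open>Equiv\<close> in terms of related
  pairs\<close>

lemma carrier_Equiv: "m \<in> carrier (Equiv C X) \<longleftrightarrow> equivalence_relation C X m"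
  by (simp add: Equiv_def)

lemma le_Equiv:
  assumes "equivalence_relation C X m" "equivalence_relation C X n"
  shows "m \<sqsubseteq>\<^bsub>Equiv C X\<^esub> n \<longleftrightarrow> (\<forall>T a b. rel m T a b \<longrightarrow> rel n T a b)"
  using subobject_le_equiv_iff[OF assms] by (simp add: Equiv_def)

lemma eq_Equiv:
  assumes "equivalence_relation C X m" "equivalence_relation C X n"
  shows "m .=\<^bsub>Equiv C X\<^esub> n \<longleftrightarrow> (\<forall>T a b. rel m T a b \<longleftrightarrow> rel n T a b)"
  using subobject_le_equiv_iff[OF assms] subobject_le_equiv_iff[OF assms(2,1)]
  by (auto simp: Equiv_def)

text \<open>Mutual inclusion plays the part of equality and does not identify the representing
  monomorphisms, hence the weak versions of the order and lattice locales.\<close>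

lemma weak_partial_order_Equiv: "weak_partial_order (Equiv C X)"
proof
  show "x \<sqsubseteq>\<^bsub>Equiv C X\<^esub> x" if "x \<in> carrier (Equiv C X)" for x
    using that by (simp add: carrier_Equiv le_Equiv)
  show le_trans: "x \<sqsubseteq>\<^bsub>Equiv C X\<^esub> z"
    if "x \<sqsubseteq>\<^bsub>Equiv C X\<^esub> y" "y \<sqsubseteq>\<^bsub>Equiv C X\<^esub> z" "x \<in> carrier (Equiv C X)" "y \<in> carrier (Equiv C X)"
      "z \<in> carrier (Equiv C X)" for x y z
    using that unfolding carrier_Equiv by (metis le_Equiv)
  have eq: "x .=\<^bsub>Equiv C X\<^esub> y \<longleftrightarrow> x \<sqsubseteq>\<^bsub>Equiv C X\<^esub> y \<and> y \<sqsubseteq>\<^bsub>Equiv C X\<^esub> x" for x y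
    by (simp add: Equiv_def)
  show "x .=\<^bsub>Equiv C X\<^esub> x" if "x \<in> carrier (Equiv C X)" for x
    using that by (simp add: carrier_Equiv eq_Equiv)
  show "y .=\<^bsub>Equiv C X\<^esub> x" if "x .=\<^bsub>Equiv C X\<^esub> y" for x y
    using that eq by blast
  show "x .=\<^bsub>Equiv C X\<^esub> y" if "x \<sqsubseteq>\<^bsub>Equiv C X\<^esub> y" "y \<sqsubseteq>\<^bsub>Equiv C X\<^esub> x" for x y
    using that eq by blast
  show "x .=\<^bsub>Equiv C X\<^esub> z"
    if "x .=\<^bsub>Equiv C X\<^esub> y" "y .=\<^bsub>Equiv C X\<^esub> z" "x \<in> carrier (Equiv C X)" "y \<in> carrier (Equiv C X)"
      "z \<in> carrier (Equiv C X)" for x y z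
    using that eq le_trans by blast
  show "x \<sqsubseteq>\<^bsub>Equiv C X\<^esub> z \<longleftrightarrow> y \<sqsubseteq>\<^bsub>Equiv C X\<^esub> w"
    if "x .=\<^bsub>Equiv C X\<^esub> y" "z .=\<^bsub>Equiv C X\<^esub> w" "x \<in> carrier (Equiv C X)" "y \<in> carrier (Equiv C X)"
      "z \<in> carrier (Equiv C X)" "w \<in> carrier (Equiv C X)" for x y z w
    using that eq le_trans by meson
qed

lemma weak_lattice_Equiv: "weak_lattice (Equiv C X)"
proof -
  interpret weak_partial_order "Equiv C X"
    by (rule weak_partial_order_Equiv)
  show ?thesis
  proof
    fix m n assume "m \<in> carrier (Equiv C X)" "n \<in> carrier (Equiv C X)"
    then have mn: "equivalence_relation C X m" "equivalence_relation C X n"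
      by (simp_all add: carrier_Equiv)
    note rel = mn[THEN equivalence_relationD(1)]
    obtain c where c: "equivalence_relation C X c" "\<And>T a b. rel c T a b \<longleftrightarrow> rcomp m n T a b"
      using equivalence_composite[OF mn] by blast
    have "least (Equiv C X) c (Upper (Equiv C X) {m, n})"
    proof (rule least_UpperI)
      fix k assume "k \<in> Upper (Equiv C X) {m, n}"
      then have k: "equivalence_relation C X k" "m \<sqsubseteq>\<^bsub>Equiv C X\<^esub> k" "n \<sqsubseteq>\<^bsub>Equiv C X\<^esub> k"
        using mn by (auto simp: Upper_def carrier_Equiv)
      then show "c \<sqsubseteq>\<^bsub>Equiv C X\<^esub> k"
        using rcomp_least[OF k(1), of m n]
        unfolding le_Equiv[OF mn(1) k(1)] le_Equiv[OF mn(2) k(1)] le_Equiv[OF c(1) k(1)] c(2) by blast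
    next
      fix k assume "k \<in> {m, n}"
      then show "k \<sqsubseteq>\<^bsub>Equiv C X\<^esub> c"
        using rcomp_left[OF rel(1) mn(2)] rcomp_right[OF mn(1) rel(2)] le_Equiv[OF _ c(1)] mn
        unfolding c(2) by blast
    qed (use c(1) mn in \<open>auto simp: carrier_Equiv\<close>)
    then show "\<exists>s. least (Equiv C X) s (Upper (Equiv C X) {m, n})"
      by blast
    obtain d where d: "equivalence_relation C X d" "\<And>T a b. rel d T a b \<longleftrightarrow> rel m T a b \<and> rel n T a b"
      using equivalence_intersection[OF mn] by blast
    have "greatest (Equiv C X) d (Lower (Equiv C X) {m, n})"
    proof (rule greatest_LowerI)
      fix k assume "k \<in> Lower (Equiv C X) {m, n}"
      then have k: "equivalence_relation C X k" "k \<sqsubseteq>\<^bsub>Equiv C X\<^esub> m" "k \<sqsubseteq>\<^bsub>Equiv C X\<^esub> n"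
        using mn by (auto simp: Lower_def carrier_Equiv)
      then show "k \<sqsubseteq>\<^bsub>Equiv C X\<^esub> d"
        unfolding le_Equiv[OF k(1) mn(1)] le_Equiv[OF k(1) mn(2)] le_Equiv[OF k(1) d(1)] d(2) by blast
    next
      fix k assume "k \<in> {m, n}"
      then show "d \<sqsubseteq>\<^bsub>Equiv C X\<^esub> k"
        using le_Equiv[OF d(1)] mn unfolding d(2) by blast
    qed (use d(1) mn in \<open>auto simp: carrier_Equiv\<close>)
    then show "\<exists>s. greatest (Equiv C X) s (Lower (Equiv C X) {m, n})"
      by blast
  qed
qed

interpretation Equiv: weak_lattice "Equiv C X"
  by (rule weak_lattice_Equiv)

text \<open>The join is a choice among the least upper bounds. Membership is invariant under mutual
  inclusion, so comparing the join with the composite in both directions determines its related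
  pairs.\<close>

lemma join_Equiv:
  assumes "equivalence_relation C X m" "equivalence_relation C X n"
  shows "equivalence_relation C X (m \<squnion>\<^bsub>Equiv C X\<^esub> n)"
    "rel (m \<squnion>\<^bsub>Equiv C X\<^esub> n) T a b \<longleftrightarrow> rcomp m n T a b"
proof -
  have carr: "m \<in> carrier (Equiv C X)" "n \<in> carrier (Equiv C X)"
    using assms by (simp_all add: carrier_Equiv)
  note rel = assms[THEN equivalence_relationD(1)]
  show eq: "equivalence_relation C X (m \<squnion>\<^bsub>Equiv C X\<^esub> n)"
    using Equiv.join_closed[OF carr] by (simp add: carrier_Equiv)
  obtain c where c: "equivalence_relation C X c" "\<And>T a b. rel c T a b \<longleftrightarrow> rcomp m n T a b"
    using equivalence_composite[OF assms] by blast
  have "m \<squnion>\<^bsub>Equiv C X\<^esub> n \<sqsubseteq>\<^bsub>Equiv C X\<^esub> c"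
  proof (rule Equiv.join_le[OF _ _ carr])
    show "m \<sqsubseteq>\<^bsub>Equiv C X\<^esub> c" "n \<sqsubseteq>\<^bsub>Equiv C X\<^esub> c"
      using rcomp_left[OF rel(1) assms(2)] rcomp_right[OF assms(1) rel(2)]
      unfolding le_Equiv[OF assms(1) c(1)] le_Equiv[OF assms(2) c(1)] c(2) by blast+
  qed (use c(1) in \<open>simp add: carrier_Equiv\<close>)
  then show "rel (m \<squnion>\<^bsub>Equiv C X\<^esub> n) T a b \<longleftrightarrow> rcomp m n T a b"
    using rcomp_least[OF eq, of m n] Equiv.join_left[OF carr] Equiv.join_right[OF carr]
    unfolding le_Equiv[OF eq c(1)] le_Equiv[OF assms(1) eq] le_Equiv[OF assms(2) eq] c(2) by blast
qed

lemma meet_Equiv: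
  assumes "equivalence_relation C X m" "equivalence_relation C X n"
  shows "equivalence_relation C X (m \<sqinter>\<^bsub>Equiv C X\<^esub> n)"
    "rel (m \<sqinter>\<^bsub>Equiv C X\<^esub> n) T a b \<longleftrightarrow> rel m T a b \<and> rel n T a b"
proof -
  have carr: "m \<in> carrier (Equiv C X)" "n \<in> carrier (Equiv C X)"
    using assms by (simp_all add: carrier_Equiv)
  show eq: "equivalence_relation C X (m \<sqinter>\<^bsub>Equiv C X\<^esub> n)"
    using Equiv.meet_closed[OF carr] by (simp add: carrier_Equiv)
  obtain c where c: "equivalence_relation C X c" "\<And>T a b. rel c T a b \<longleftrightarrow> rel m T a b \<and> rel n T a b"
    using equivalence_intersection[OF assms] by blast
  have "c \<sqsubseteq>\<^bsub>Equiv C X\<^esub> m \<sqinter>\<^bsub>Equiv C X\<^esub> n"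
  proof (rule Equiv.meet_le)
    show "c \<sqsubseteq>\<^bsub>Equiv C X\<^esub> m" "c \<sqsubseteq>\<^bsub>Equiv C X\<^esub> n"
      unfolding le_Equiv[OF c(1) assms(1)] le_Equiv[OF c(1) assms(2)] c(2) by blast+
  qed (use c(1) carr in \<open>simp_all add: carrier_Equiv\<close>)
  then show "rel (m \<sqinter>\<^bsub>Equiv C X\<^esub> n) T a b \<longleftrightarrow> rel m T a b \<and> rel n T a b"
    using Equiv.meet_left[OF carr] Equiv.meet_right[OF carr]
    unfolding le_Equiv[OF c(1) eq] le_Equiv[OF eq assms(1)] le_Equiv[OF eq assms(2)] c(2) by blast
qed

text \<open>One inequality of the distributive law holds in every lattice (\<open>ge\<close>), so
  only the other one is left to express: a pair in \<open>k\<close> that is joined through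
  \<open>m\<close> and \<open>n\<close> is locally joined by a middle element that stays in the same
  class of \<open>k\<close>.\<close>

lemma distributive_lattice_Equiv_iff:
  "distributive_lattice (Equiv C X) \<longleftrightarrow>
    (\<forall>k m n. equivalence_relation C X k \<longrightarrow> equivalence_relation C X m \<longrightarrow> equivalence_relation C X n \<longrightarrow>
      (\<forall>T a b. rel k T a b \<and> rcomp m n T a b \<longrightarrow>
        (\<exists>T' e y. e \<in> Cover T' T \<and> (rel k T' (a \<cdot> e) y \<and> rel m T' (a \<cdot> e) y) \<and>
          rel k T' y (b \<cdot> e) \<and> rel n T' y (b \<cdot> e))))"
proof -
  define D where "D k m n \<longleftrightarrow> k \<sqinter>\<^bsub>Equiv C X\<^esub> (m \<squnion>\<^bsub>Equiv C X\<^esub> n) .=\<^bsub>Equiv C X\<^esub>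
      (k \<sqinter>\<^bsub>Equiv C X\<^esub> m) \<squnion>\<^bsub>Equiv C X\<^esub> (k \<sqinter>\<^bsub>Equiv C X\<^esub> n)" for k m n
  define R where "R k m n \<longleftrightarrow> (\<forall>T a b. rel k T a b \<and> rcomp m n T a b \<longrightarrow>
        (\<exists>T' e y. e \<in> Cover T' T \<and> (rel k T' (a \<cdot> e) y \<and> rel m T' (a \<cdot> e) y) \<and>
          rel k T' y (b \<cdot> e) \<and> rel n T' y (b \<cdot> e)))" for k m n
  have "D k m n \<longleftrightarrow> R k m n"
    if kmn: "equivalence_relation C X k" "equivalence_relation C X m" "equivalence_relation C X n"
    for k m n
  proof -
    let ?km = "k \<sqinter>\<^bsub>Equiv C X\<^esub> m" and ?kn = "k \<sqinter>\<^bsub>Equiv C X\<^esub> n"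
    note km = meet_Equiv[OF kmn(1,2)] and kn = meet_Equiv[OF kmn(1,3)]
    note mn = join_Equiv[OF kmn(2,3)]
    have ge: "rel k T a b \<and> rcomp m n T a b" if ab: "rcomp ?km ?kn T a b" for T a b
    proof -
      have "rcomp m n T a b"
        using ab unfolding rcomp_def km kn by blast
      with rcomp_least[OF kmn(1) _ _ ab] km(2) kn(2) show ?thesis
        by blast
    qed
    have "D k m n \<longleftrightarrow> (\<forall>T a b. rel k T a b \<and> rcomp m n T a b \<longleftrightarrow> rcomp ?km ?kn T a b)"
      using eq_Equiv[OF meet_Equiv(1)[OF kmn(1) mn(1)] join_Equiv(1)[OF km(1) kn(1)]]
      unfolding D_def meet_Equiv(2)[OF kmn(1) mn(1)] join_Equiv(2)[OF km(1) kn(1)] mn(2) .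
    also have "\<dots> \<longleftrightarrow> (\<forall>T a b. rel k T a b \<and> rcomp m n T a b \<longrightarrow> rcomp ?km ?kn T a b)"
      using ge by blast
    also have "\<dots> \<longleftrightarrow> R k m n"
      using rel_Hom[OF equivalence_relationD(1)[OF kmn(1)]] unfolding R_def rcomp_def km(2) kn(2) by blast
    finally show ?thesis .
  qed
  then show ?thesis
    using weak_lattice_Equiv
    unfolding distributive_lattice_def carrier_Equiv Ball_def D_def[symmetric] R_def[symmetric] by blast
qed

end


section \<open>The Chinese remainder condition through generalized elements\<close>

lemma crt_diagram_simps:
  "Nodes (crt_diagram C n r D u v) =
    {Quot i |i. 1 \<le> i \<and> i \<le> n} \<union> {Push i j |i j. 1 \<le> i \<and> i < j \<and> j \<le> n}"
  "Edges (crt_diagram C n r D u v) =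
    {Left i j |i j. 1 \<le> i \<and> i < j \<and> j \<le> n} \<union> {Right i j |i j. 1 \<le> i \<and> i < j \<and> j \<le> n}"
  "Src (crt_diagram C n r D u v) (Left i j) = Quot i"
  "Src (crt_diagram C n r D u v) (Right i j) = Quot j"
  "Tgt (crt_diagram C n r D u v) (Left i j) = Push i j"
  "Tgt (crt_diagram C n r D u v) (Right i j) = Push i j"
  "ObAt (crt_diagram C n r D u v) (Quot i) = Cod C (r i)"
  "ObAt (crt_diagram C n r D u v) (Push i j) = D i j"
  "MorAt (crt_diagram C n r D u v) (Left i j) = u i j"
  "MorAt (crt_diagram C n r D u v) (Right i j) = v i j"
  by (simp_all add: crt_diagram_def)

lemma crt_diagram_finite:
  "finite (Nodes (crt_diagram C n r D u v))" "finite (Edges (crt_diagram C n r D u v))"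
proof -
  have "Nodes (crt_diagram C n r D u v) \<subseteq> Quot ` {..n} \<union> (\<lambda>(i, j). Push i j) ` ({..n} \<times> {..n})"
    by (auto simp: crt_diagram_simps)
  then show "finite (Nodes (crt_diagram C n r D u v))"
    by (rule finite_subset) auto
  have "Edges (crt_diagram C n r D u v) \<subseteq>
      (\<lambda>(i, j). Left i j) ` ({..n} \<times> {..n}) \<union> (\<lambda>(i, j). Right i j) ` ({..n} \<times> {..n})"
    by (auto simp: crt_diagram_simps)
  then show "finite (Edges (crt_diagram C n r D u v))"
    by (rule finite_subset) auto
qed

context category
begin

lemma pushout_Hom:
  assumes "is_pushout C f g D u v" "f \<in> Hom C X Y" "g \<in> Hom C X Z"
  shows "u \<in> Hom C Y D" "v \<in> Hom C Z D" "u \<cdot> f = v \<cdot> g"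
  using assms by (simp_all add: is_pushout_def Hom_def)

lemma pushout_lift:
  assumes "is_pushout C f g D u v" "f \<in> Hom C X Y" "g \<in> Hom C X Z"
    "a \<in> Hom C Y W" "b \<in> Hom C Z W" "a \<cdot> f = b \<cdot> g"
  shows "\<exists>h \<in> Hom C D W. h \<cdot> u = a \<and> h \<cdot> v = b"
proof -
  have "a \<in> Hom C (Cod C f) W" "b \<in> Hom C (Cod C g) W"
    using assms by (simp_all add: Hom_def)
  with assms(1,6) show ?thesis
    unfolding is_pushout_def by blast
qed

end

context regular
begin

text \<open>\<open>X\<close> maps onto the limit iff every family of elements of \<open>X\<close> that is pairwise compatible in the
  pushouts has a local simultaneous solution.\<close>

lemma comparison_regular_epi_iff:
  assumes X: "X \<in> Obj C"
    and r: "\<And>i. 1 \<le> i \<Longrightarrow> i \<le> n \<Longrightarrow> r i \<in> Cover X (Cod C (r i))"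
    and push: "\<And>i j. 1 \<le> i \<Longrightarrow> i < j \<Longrightarrow> j \<le> n \<Longrightarrow> is_pushout C (r i) (r j) (D i j) (u i j) (v i j)"
    and L: "is_limit C (crt_diagram C n r D u v) L p"
  shows "regular_epi C (comparison C (crt_diagram C n r D u v) X (crt_cone C r u) L p) \<longleftrightarrow>
    (\<forall>T x. T \<in> Obj C \<and> (\<forall>i. 1 \<le> i \<and> i \<le> n \<longrightarrow> x i \<in> Hom C T X) \<and>
        (\<forall>i j. 1 \<le> i \<and> i < j \<and> j \<le> n \<longrightarrow> u i j \<cdot> (r i \<cdot> x i) = u i j \<cdot> (r i \<cdot> x j)) \<longrightarrow>
      (\<exists>T' e z. e \<in> Cover T' T \<and> z \<in> Hom C T' X \<and>
        (\<forall>i. 1 \<le> i \<and> i \<le> n \<longrightarrow> r i \<cdot> z = r i \<cdot> (x i \<cdot> e))))" (is "?E \<longleftrightarrow> ?S")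
proof -
  let ?G = "crt_diagram C n r D u v"
  let ?c = "comparison C ?G X (crt_cone C r u) L p"
  note rH = CoverD(1)[OF r]
  have uv: "u i j \<in> Hom C (Cod C (r i)) (D i j)" "v i j \<in> Hom C (Cod C (r j)) (D i j)"
      "u i j \<cdot> r i = v i j \<cdot> r j" if "1 \<le> i" "i < j" "j \<le> n" for i j
    using pushout_Hom[OF push[OF that] rH rH] that by simp_all
  have cone_iff: "is_cone C ?G Y q \<longleftrightarrow> Y \<in> Obj C \<and>
      (\<forall>i. 1 \<le> i \<and> i \<le> n \<longrightarrow> q (Quot i) \<in> Hom C Y (Cod C (r i))) \<and>
      (\<forall>i j. 1 \<le> i \<and> i < j \<and> j \<le> n \<longrightarrow> q (Push i j) \<in> Hom C Y (D i j) \<and>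
        u i j \<cdot> q (Quot i) = q (Push i j) \<and> v i j \<cdot> q (Quot j) = q (Push i j))" for Y q
  proof -
    have nodes: "(\<forall>a \<in> Nodes ?G. Q a) \<longleftrightarrow> (\<forall>i. 1 \<le> i \<and> i \<le> n \<longrightarrow> Q (Quot i)) \<and>
        (\<forall>i j. 1 \<le> i \<and> i < j \<and> j \<le> n \<longrightarrow> Q (Push i j))" for Q
      unfolding crt_diagram_simps by blast
    have edges: "(\<forall>a \<in> Edges ?G. Q a) \<longleftrightarrow>
        (\<forall>i j. 1 \<le> i \<and> i < j \<and> j \<le> n \<longrightarrow> Q (Left i j) \<and> Q (Right i j))" for Q
      unfolding crt_diagram_simps by blast
    show ?thesis
      unfolding is_cone_def nodes edges unfolding crt_diagram_simps by blast
  qed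
  have cone_p: "is_cone C ?G L p"
    using L by (simp add: is_limit_def)
  then have pH: "L \<in> Obj C" "\<And>i. 1 \<le> i \<Longrightarrow> i \<le> n \<Longrightarrow> p (Quot i) \<in> Hom C L (Cod C (r i))"
    and pu: "\<And>i j. 1 \<le> i \<Longrightarrow> i < j \<Longrightarrow> j \<le> n \<Longrightarrow> u i j \<cdot> p (Quot i) = p (Push i j)"
    and pv: "\<And>i j. 1 \<le> i \<Longrightarrow> i < j \<Longrightarrow> j \<le> n \<Longrightarrow> v i j \<cdot> p (Quot j) = p (Push i j)"
    unfolding cone_iff by blast+
  \<comment> \<open>The legs to the pushouts are determined by the legs to the quotients, so only
    the latter have to be compared.\<close>
  have mor_iff: "is_cone_morphism C ?G Y q L p h \<longleftrightarrow>
      h \<in> Hom C Y L \<and> (\<forall>i. 1 \<le> i \<and> i \<le> n \<longrightarrow> p (Quot i) \<cdot> h = q (Quot i))"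
    if q: "is_cone C ?G Y q" for Y q h
  proof -
    have "p (Push i j) \<cdot> h = q (Push i j)"
      if h: "h \<in> Hom C Y L" "\<forall>i. 1 \<le> i \<and> i \<le> n \<longrightarrow> p (Quot i) \<cdot> h = q (Quot i)"
        and ij: "1 \<le> i" "i < j" "j \<le> n" for i j
    proof -
      have i: "1 \<le> i" "i \<le> n"
        using ij by auto
      have "p (Push i j) \<cdot> h = u i j \<cdot> q (Quot i)"
        using comp_comp_eq[OF pu[OF ij] h(1) pH(2)[OF i] uv(1)[OF ij]] h(2) i by simp
      then show ?thesis
        using q ij unfolding cone_iff by metis
    qed
    then show ?thesis
      unfolding is_cone_morphism_def crt_diagram_simps by blast
  qed
  have ex1: "\<exists>!h. is_cone_morphism C ?G Y q L p h" if "is_cone C ?G Y q" for Y q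
    using L that by (simp add: is_limit_def)
  \<comment> \<open>Consequently the legs to the quotients alone are jointly monic on the
    limit.\<close>
  have p_cancel: "h = k" if hk: "h \<in> Hom C T L" "k \<in> Hom C T L"
      "\<And>i. 1 \<le> i \<Longrightarrow> i \<le> n \<Longrightarrow> p (Quot i) \<cdot> h = p (Quot i) \<cdot> k" for T h k
  proof -
    have eqs: "u i j \<cdot> (p (Quot i) \<cdot> k) = p (Push i j) \<cdot> k" "v i j \<cdot> (p (Quot j) \<cdot> k) = p (Push i j) \<cdot> k"
      if ij: "1 \<le> i" "i < j" "j \<le> n" for i j
      using ij comp_comp_eq[OF pu[OF ij] hk(2) pH(2) uv(1)[OF ij]]
        comp_comp_eq[OF pv[OF ij] hk(2) pH(2) uv(2)[OF ij]] by simp_all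
    have "is_cone C ?G T (\<lambda>a. p a \<cdot> k)"
      using Hom_Obj[OF hk(1)] eqs Hom_comp[OF hk(2)] cone_p unfolding cone_iff by blast
    note mor_iff[OF this] ex1[OF this]
    then show ?thesis
      using hk by metis
  qed
  have cone_c: "is_cone C ?G X (crt_cone C r u)"
    unfolding cone_iff
  proof (intro conjI allI impI)
    show "crt_cone C r u (Quot i) \<in> Hom C X (Cod C (r i))" if "1 \<le> i \<and> i \<le> n" for i
      using that rH by (simp add: crt_cone_def)
    fix i j assume "1 \<le> i \<and> i < j \<and> j \<le> n"
    then have ij: "1 \<le> i" "i < j" "j \<le> n" "i \<le> n"
      by auto
    show "crt_cone C r u (Push i j) \<in> Hom C X (D i j)"
      using Hom_comp[OF rH[OF ij(1,4)] uv(1)[OF ij(1-3)]] by (simp add: crt_cone_def)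
    show "u i j \<cdot> crt_cone C r u (Quot i) = crt_cone C r u (Push i j)"
      "v i j \<cdot> crt_cone C r u (Quot j) = crt_cone C r u (Push i j)"
      using uv(3)[OF ij(1-3)] by (simp_all add: crt_cone_def)
  qed (rule X)
  have "is_cone_morphism C ?G X (crt_cone C r u) L p ?c"
    unfolding comparison_def by (rule theI') (rule ex1[OF cone_c])
  then have cH: "?c \<in> Hom C X L" and pc: "\<And>i. 1 \<le> i \<Longrightarrow> i \<le> n \<Longrightarrow> p (Quot i) \<cdot> ?c = r i"
    unfolding mor_iff[OF cone_c] by (simp_all add: crt_cone_def)
  show ?thesis
  proof
    assume ?E
    with cH have c: "?c \<in> Cover X L"
      by (simp add: Cover_def)
    show ?S
    proof (intro allI impI, elim conjE)
      fix T x
      assume T: "T \<in> Obj C" and x: "\<forall>i. 1 \<le> i \<and> i \<le> n \<longrightarrow> x i \<in> Hom C T X"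
        and compat: "\<forall>i j. 1 \<le> i \<and> i < j \<and> j \<le> n \<longrightarrow> u i j \<cdot> (r i \<cdot> x i) = u i j \<cdot> (r i \<cdot> x j)"
      define q where "q a = (case a of Quot i \<Rightarrow> r i \<cdot> x i | Push i j \<Rightarrow> u i j \<cdot> (r i \<cdot> x i))" for a
      have q: "is_cone C ?G T q"
        unfolding cone_iff
      proof (intro conjI allI impI)
        show "q (Quot i) \<in> Hom C T (Cod C (r i))" if "1 \<le> i \<and> i \<le> n" for i
          using that Hom_comp[OF _ rH] x by (simp add: q_def)
        fix i j assume "1 \<le> i \<and> i < j \<and> j \<le> n"
        then have ij: "1 \<le> i" "i < j" "j \<le> n" "i \<le> n" "1 \<le> j"
          by auto
        have xi: "x i \<in> Hom C T X" and xj: "x j \<in> Hom C T X"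
          using x ij by auto
        show "q (Push i j) \<in> Hom C T (D i j)"
          using Hom_comp[OF Hom_comp[OF xi rH[OF ij(1,4)]] uv(1)[OF ij(1-3)]] by (simp add: q_def)
        show "u i j \<cdot> q (Quot i) = q (Push i j)"
          by (simp add: q_def)
        \<comment> \<open>Compatibility is stated with \<open>u i j\<close> and \<open>r i\<close>
          for both elements, whereas a cone uses \<open>v i j\<close> and \<open>r j\<close> for the
          second; the pushout square exchanges the two forms.\<close>
        have "v i j \<cdot> (r j \<cdot> x j) = (u i j \<cdot> r i) \<cdot> x j"
          using comp_comp_eq[OF uv(3)[OF ij(1-3), symmetric] xj rH[OF ij(5,3)] uv(2)[OF ij(1-3)]] .
        also have "\<dots> = u i j \<cdot> (r i \<cdot> x j)"
          using comp_comp_eq[OF refl xj rH[OF ij(1,4)] uv(1)[OF ij(1-3)]] by simp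
        finally show "v i j \<cdot> q (Quot j) = q (Push i j)"
          using compat[rule_format, of i j] ij by (simp add: q_def)
      qed (rule T)
      then obtain h where h: "h \<in> Hom C T L" "\<And>i. 1 \<le> i \<Longrightarrow> i \<le> n \<Longrightarrow> p (Quot i) \<cdot> h = r i \<cdot> x i"
        using ex1[OF q] unfolding mor_iff[OF q] by (auto simp: q_def)
      obtain T' e z where e: "e \<in> Cover T' T" "z \<in> Hom C T' X" "?c \<cdot> z = h \<cdot> e"
        using Cover_lift[OF c h(1)] by blast
      have "r i \<cdot> z = r i \<cdot> (x i \<cdot> e)" if i: "1 \<le> i" "i \<le> n" for i
      proof -
        have xi: "x i \<in> Hom C T X"
          using x i by simp
        have "r i \<cdot> z = p (Quot i) \<cdot> (?c \<cdot> z)"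
          using comp_comp_eq[OF pc[OF i] e(2) cH pH(2)[OF i]] by simp
        also have "\<dots> = (r i \<cdot> x i) \<cdot> e"
          using e(3) comp_comp_eq[OF h(2)[OF i] CoverD(1)[OF e(1)] h(1) pH(2)[OF i]] by simp
        also have "\<dots> = r i \<cdot> (x i \<cdot> e)"
          using comp_comp_eq[OF refl CoverD(1)[OF e(1)] xi rH[OF i]] by simp
        finally show ?thesis .
      qed
      with e show "\<exists>T' e z. e \<in> Cover T' T \<and> z \<in> Hom C T' X \<and>
          (\<forall>i. 1 \<le> i \<and> i \<le> n \<longrightarrow> r i \<cdot> z = r i \<cdot> (x i \<cdot> e))"
        by blast
    qed
  next
    assume S: ?S
    \<comment> \<open>The generic element of \<open>L\<close> is its identity. Its components are
      lifted to \<open>X\<close> along the maps \<open>r i\<close> one index at a time, and the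
      cover, initially the identity of \<open>L\<close>, grows by one composition at each
      step.\<close>
    have "\<exists>T e x. e \<in> Cover T L \<and> (\<forall>i. 1 \<le> i \<and> i \<le> k \<longrightarrow> x i \<in> Hom C T X \<and> r i \<cdot> x i = p (Quot i) \<cdot> e)"
      if "k \<le> n" for k
      using that
    proof (induction k)
      case 0
      then show ?case
        using Cover_Ident[OF pH(1)] by auto
    next
      case (Suc k)
      then obtain T e x where e: "e \<in> Cover T L"
        and x: "\<And>i. 1 \<le> i \<Longrightarrow> i \<le> k \<Longrightarrow> x i \<in> Hom C T X \<and> r i \<cdot> x i = p (Quot i) \<cdot> e"
        by auto
      note eH = CoverD(1)[OF e]
      have k: "1 \<le> Suc k" "Suc k \<le> n"
        using Suc by auto
      obtain T' d y where d: "d \<in> Cover T' T" "y \<in> Hom C T' X"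
          "r (Suc k) \<cdot> y = (p (Quot (Suc k)) \<cdot> e) \<cdot> d"
        using Cover_lift[OF r[OF k] Hom_comp[OF eH pH(2)[OF k]]] by blast
      note dH = CoverD(1)[OF d(1)]
      have assoc: "(p (Quot i) \<cdot> e) \<cdot> d = p (Quot i) \<cdot> (e \<cdot> d)" if "1 \<le> i" "i \<le> n" for i
        using comp_comp_eq[OF refl dH eH pH(2)[OF that]] by simp
      have "x i \<cdot> d \<in> Hom C T' X \<and> r i \<cdot> (x i \<cdot> d) = p (Quot i) \<cdot> (e \<cdot> d)" if i: "1 \<le> i" "i \<le> k" for i
      proof -
        have xi: "x i \<in> Hom C T X" "r i \<cdot> x i = p (Quot i) \<cdot> e" and "i \<le> n"
          using x[OF i] i k by auto
        then show ?thesis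
          using Hom_comp[OF dH xi(1)] comp_comp_eq[OF xi(2) dH xi(1) rH[OF i(1)]] assoc[OF i(1)] by simp
      qed
      then show ?case
        using Cover_comp[OF d(1) e] d(2,3) assoc[OF k]
        by (intro exI[of _ T'] exI[of _ "e \<cdot> d"] exI[of _ "\<lambda>i. if i \<le> k then x i \<cdot> d else y"])
          (auto simp: not_le le_Suc_eq)
    qed
    then obtain T e x where e: "e \<in> Cover T L"
      and x: "\<And>i. 1 \<le> i \<Longrightarrow> i \<le> n \<Longrightarrow> x i \<in> Hom C T X"
      and rx: "\<And>i. 1 \<le> i \<Longrightarrow> i \<le> n \<Longrightarrow> r i \<cdot> x i = p (Quot i) \<cdot> e"
      by blast
    note eH = CoverD(1)[OF e]
    have compat: "u i j \<cdot> (r i \<cdot> x i) = u i j \<cdot> (r i \<cdot> x j)" if "1 \<le> i \<and> i < j \<and> j \<le> n" for i j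
    proof -
      have ij: "1 \<le> i" "i < j" "j \<le> n" and i: "1 \<le> i" "i \<le> n" and j: "1 \<le> j" "j \<le> n"
        using that by auto
      have "u i j \<cdot> (r i \<cdot> x i) = p (Push i j) \<cdot> e"
        using comp_comp_eq[OF pu[OF ij] eH pH(2)[OF i] uv(1)[OF ij]] rx[OF i] by simp
      also have "\<dots> = v i j \<cdot> (r j \<cdot> x j)"
        using comp_comp_eq[OF pv[OF ij] eH pH(2)[OF j] uv(2)[OF ij]] rx[OF j] by simp
      also have "\<dots> = u i j \<cdot> (r i \<cdot> x j)"
        using comp_comp_eq[OF uv(3)[OF ij, symmetric] x[OF j] rH[OF j] uv(2)[OF ij]]
          comp_comp_eq[OF refl x[OF j] rH[OF i] uv(1)[OF ij]] by simp
      finally show ?thesis .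
    qed
    have "T \<in> Obj C \<and> (\<forall>i. 1 \<le> i \<and> i \<le> n \<longrightarrow> x i \<in> Hom C T X) \<and>
        (\<forall>i j. 1 \<le> i \<and> i < j \<and> j \<le> n \<longrightarrow> u i j \<cdot> (r i \<cdot> x i) = u i j \<cdot> (r i \<cdot> x j))"
      using x Hom_Obj(1)[OF eH] by (intro conjI allI impI compat) simp_all
    from S[THEN spec, THEN spec, THEN mp, OF this]
    obtain T' d z where d: "d \<in> Cover T' T" "z \<in> Hom C T' X"
        and z: "\<And>i. 1 \<le> i \<Longrightarrow> i \<le> n \<Longrightarrow> r i \<cdot> z = r i \<cdot> (x i \<cdot> d)"
      by blast
    note dH = CoverD(1)[OF d(1)]
    \<comment> \<open>The solution of the system formed by the lifts is a preimage of the generic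
      element over the cover \<open>e \<cdot> d\<close>, so cancelling \<open>z\<close> leaves a
      cover.\<close>
    have "?c \<cdot> z = e \<cdot> d"
    proof (rule p_cancel[OF Hom_comp[OF d(2) cH] Hom_comp[OF dH eH]])
      fix i assume i: "1 \<le> i" "i \<le> n"
      show "p (Quot i) \<cdot> (?c \<cdot> z) = p (Quot i) \<cdot> (e \<cdot> d)"
        using comp_comp_eq[OF pc[OF i] d(2) cH pH(2)[OF i]] z[OF i]
          comp_comp_eq[OF rx[OF i] dH x[OF i] rH[OF i]] comp_comp_eq[OF refl dH eH pH(2)[OF i]] by simp
    qed
    then show ?E
      using Cover_right_cancel[OF _ d(2) cH] Cover_comp[OF d(1) e] CoverD(2) by simp
  qed
qed

text \<open>The form in which \<open>CRT\<close> is applied: pushouts are chosen as functions of the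
  indices, finite completeness gives the limit, and the regular epimorphism is traded for local
  solutions. The bound \<open>1 \<le> n\<close> makes \<open>X\<close> an object, as the domain of
  \<open>r 1\<close>.\<close>

lemma CRT_solve:
  assumes "CRT C n" "1 \<le> n" "\<And>i. 1 \<le> i \<Longrightarrow> i \<le> n \<Longrightarrow> r i \<in> Cover X (Cod C (r i))"
  obtains D u v where
    "\<And>i j. 1 \<le> i \<Longrightarrow> i < j \<Longrightarrow> j \<le> n \<Longrightarrow> is_pushout C (r i) (r j) (D i j) (u i j) (v i j)"
    "\<And>T x. T \<in> Obj C \<Longrightarrow> (\<And>i. 1 \<le> i \<Longrightarrow> i \<le> n \<Longrightarrow> x i \<in> Hom C T X) \<Longrightarrow>
        (\<And>i j. 1 \<le> i \<Longrightarrow> i < j \<Longrightarrow> j \<le> n \<Longrightarrow> u i j \<cdot> (r i \<cdot> x i) = u i j \<cdot> (r i \<cdot> x j)) \<Longrightarrow>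
      \<exists>T' e z. e \<in> Cover T' T \<and> z \<in> Hom C T' X \<and>
        (\<forall>i. 1 \<le> i \<and> i \<le> n \<longrightarrow> r i \<cdot> z = r i \<cdot> (x i \<cdot> e))"
proof -
  note rH = CoverD(1)[OF assms(3)]
  have X: "X \<in> Obj C"
    using Hom_Obj(1)[OF rH[OF order_refl assms(2)]] .
  have fam: "\<forall>i. 1 \<le> i \<and> i \<le> n \<longrightarrow> regular_epi C (r i) \<and> Dom C (r i) = X"
    using assms(3) by (auto simp: Cover_def Hom_def)
  then have "\<forall>i j. 1 \<le> i \<and> i < j \<and> j \<le> n \<longrightarrow> (\<exists>D u v. is_pushout C (r i) (r j) D u v)"
    using assms(1) unfolding CRT_def by blast
  then obtain D u v where push: "\<And>i j. 1 \<le> i \<Longrightarrow> i < j \<Longrightarrow> j \<le> n \<Longrightarrow>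
      is_pushout C (r i) (r j) (D i j) (u i j) (v i j)"
    by metis
  have uv: "u i j \<in> Hom C (Cod C (r i)) (D i j)" "v i j \<in> Hom C (Cod C (r j)) (D i j)"
    if "1 \<le> i" "i < j" "j \<le> n" for i j
    using pushout_Hom[OF push[OF that] rH rH] that by simp_all
  have "is_diagram C (crt_diagram C n r D u v)"
    using uv Hom_Obj(2)[OF rH] Hom_Obj(2)[OF uv(1)]
    unfolding is_diagram_def crt_diagram_simps by (auto simp: crt_diagram_simps)
  then obtain L p where L: "is_limit C (crt_diagram C n r D u v) L p"
    using finite_limit_exists[OF finitely_complete _ crt_diagram_finite] by blast
  have "regular_epi C (comparison C (crt_diagram C n r D u v) X (crt_cone C r u) L p)"
    using assms(1) fam push L unfolding CRT_def by blast
  note solve = comparison_regular_epi_iff[THEN iffD1, OF X assms(3) push L this,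
      THEN spec, THEN spec, THEN mp]
  show ?thesis
  proof (rule that[OF push])
    fix T x
    assume "T \<in> Obj C" "\<And>i. 1 \<le> i \<Longrightarrow> i \<le> n \<Longrightarrow> x i \<in> Hom C T X"
      "\<And>i j. 1 \<le> i \<Longrightarrow> i < j \<Longrightarrow> j \<le> n \<Longrightarrow> u i j \<cdot> (r i \<cdot> x i) = u i j \<cdot> (r i \<cdot> x j)"
    then show "\<exists>T' e z. e \<in> Cover T' T \<and> z \<in> Hom C T' X \<and>
        (\<forall>i. 1 \<le> i \<and> i \<le> n \<longrightarrow> r i \<cdot> z = r i \<cdot> (x i \<cdot> e))"
      by (intro solve conjI allI impI) (blast+)
  qed
qed

end

section \<open>From the Chinese remainder condition to arithmetical categories\<close>

context regular_object
begin

lemma kernel_map_equivalence: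
  assumes "is_relation C X m" "u \<in> Hom C X D"
    "\<And>T a b. rel m T a b \<longleftrightarrow> a \<in> Hom C T X \<and> b \<in> Hom C T X \<and> u \<cdot> a = u \<cdot> b"
  shows "equivalence_relation C X m" "effective C X m"
proof -
  show "equivalence_relation C X m"
    unfolding equivalence_relation_iff using assms(1) by (simp add: assms(3))
  show "effective C X m"
    unfolding effective_def using kernel_pair_iff[OF assms(1,2)] assms(3) by blast
qed

text \<open>The legs of a reflexive relation are split epimorphisms with a common section, so their pushout
  has equal coprojections \<open>u\<close>, and the comparison maps the relation onto the kernel pair of \<open>u\<close>.\<close>

lemma CRT2_reflexive_kernel:
  assumes "CRT C 2" "reflexive_relation C X m"
  shows "\<exists>D. \<exists>u \<in> Hom C X D. \<forall>T a b.
    rel m T a b \<longleftrightarrow> a \<in> Hom C T X \<and> b \<in> Hom C T X \<and> u \<cdot> a = u \<cdot> b"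
proof -
  have m: "is_relation C X m"
    using assms(2) by (simp add: reflexive_relation_def)
  note mH = is_relation_Hom[OF m]
  obtain s where s: "s \<in> Hom C X (Dom C m)" "leg1 C X m \<cdot> s = Ident C X" "leg2 C X m \<cdot> s = Ident C X"
    using assms(2) unfolding reflexive_relation_def by blast
  \<comment> \<open>Every index other than 1 gets the second leg, so the typing of
    \<open>r i\<close> holds without a range condition. The common domain of the family is the
    relation itself, not \<open>X\<close>.\<close>
  define r where "r i = (if i = 1 then leg1 C X m else leg2 C X m)" for i :: nat
  have cod: "Cod C (r i) = X" and r: "r i \<in> Cover (Dom C m) X" for i
    using mH split_epi_regular[OF mH(2) s(1,2)] split_epi_regular[OF mH(3) s(1,3)]
    by (auto simp: r_def Cover_def Hom_def)
  have cov: "r i \<in> Cover (Dom C m) (Cod C (r i))" for i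
    using r cod by simp
  show ?thesis
  proof (rule CRT_solve[OF assms(1) one_le_numeral cov])
    fix D u v
    assume push:
      "\<And>i j. 1 \<le> i \<Longrightarrow> i < j \<Longrightarrow> j \<le> 2 \<Longrightarrow> is_pushout C (r i) (r j) (D i j) (u i j) (v i j)"
    and solve: "\<And>T x. T \<in> Obj C \<Longrightarrow> (\<And>i. 1 \<le> i \<Longrightarrow> i \<le> 2 \<Longrightarrow> x i \<in> Hom C T (Dom C m)) \<Longrightarrow>
        (\<And>i j. 1 \<le> i \<Longrightarrow> i < j \<Longrightarrow> j \<le> 2 \<Longrightarrow> u i j \<cdot> (r i \<cdot> x i) = u i j \<cdot> (r i \<cdot> x j)) \<Longrightarrow>
      \<exists>T' e z. e \<in> Cover T' T \<and> z \<in> Hom C T' (Dom C m) \<and>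
        (\<forall>i. 1 \<le> i \<and> i \<le> 2 \<longrightarrow> r i \<cdot> z = r i \<cdot> (x i \<cdot> e))"
    have uH: "u 1 2 \<in> Hom C X (D 1 2)" "v 1 2 \<in> Hom C X (D 1 2)"
      and uv: "u 1 2 \<cdot> leg1 C X m = v 1 2 \<cdot> leg2 C X m"
      using pushout_Hom[OF push[of 1 2] CoverD(1)[OF r] CoverD(1)[OF r]] by (simp_all add: r_def)
    \<comment> \<open>Precomposing the pushout square with the common section \<open>s\<close>
      cancels both legs.\<close>
    have "u 1 2 = v 1 2"
      using comp_comp_eq[OF uv s(1) mH(2) uH(1)] comp_comp_eq[OF refl s(1) mH(3) uH(2)] s
        Comp_Ident[OF uH(1)] Comp_Ident[OF uH(2)] by simp
    with uv have u: "u 1 2 \<cdot> leg1 C X m = u 1 2 \<cdot> leg2 C X m"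
      by simp
    have "rel m T a b \<longleftrightarrow> a \<in> Hom C T X \<and> b \<in> Hom C T X \<and> u 1 2 \<cdot> a = u 1 2 \<cdot> b" for T a b
    proof
      assume ab: "rel m T a b"
      then obtain k where "k \<in> Hom C T (Dom C m)" "leg1 C X m \<cdot> k = a" "leg2 C X m \<cdot> k = b"
        by (auto simp: rel_def)
      then show "a \<in> Hom C T X \<and> b \<in> Hom C T X \<and> u 1 2 \<cdot> a = u 1 2 \<cdot> b"
        using rel_Hom[OF m ab] comp_comp_eq[OF u _ mH(2) uH(1)] comp_comp_eq[OF refl _ mH(3) uH(1)]
        by metis
    next
      assume "a \<in> Hom C T X \<and> b \<in> Hom C T X \<and> u 1 2 \<cdot> a = u 1 2 \<cdot> b"
      then have a: "a \<in> Hom C T X" and b: "b \<in> Hom C T X" and eq: "u 1 2 \<cdot> a = u 1 2 \<cdot> b"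
        by blast+
      \<comment> \<open>Both legs send \<open>s \<cdot> c\<close> to \<open>c\<close>, so
        compatibility of this family is the equation
        \<open>u 1 2 \<cdot> a = u 1 2 \<cdot> b\<close>. A solution has first leg \<open>a\<close>
        and second leg \<open>b\<close>, locally, which is membership of the pair in
        \<open>m\<close>.\<close>
      define x where "x i = (if i = 1 then s \<cdot> a else s \<cdot> b)" for i :: nat
      have legs: "leg1 C X m \<cdot> (s \<cdot> c) = c" "leg2 C X m \<cdot> (s \<cdot> c) = c" if c: "c \<in> Hom C T X" for c
        using comp_comp_eq[OF s(2) c s(1) mH(2)] comp_comp_eq[OF s(3) c s(1) mH(3)] Ident_Comp[OF c]
        by simp_all
      have "\<exists>T' e z. e \<in> Cover T' T \<and> z \<in> Hom C T' (Dom C m) \<and>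
          (\<forall>i. 1 \<le> i \<and> i \<le> 2 \<longrightarrow> r i \<cdot> z = r i \<cdot> (x i \<cdot> e))"
      proof (rule solve)
        show "T \<in> Obj C"
          using Hom_Obj(1)[OF a] .
        show "x i \<in> Hom C T (Dom C m)" for i
          using Hom_comp[OF a s(1)] Hom_comp[OF b s(1)] by (simp add: x_def)
        fix i j :: nat assume "1 \<le> i" "i < j" "j \<le> 2"
        then have "i = 1" "j = 2"
          by auto
        then show "u i j \<cdot> (r i \<cdot> x i) = u i j \<cdot> (r i \<cdot> x j)"
          using legs[OF a] legs[OF b] eq by (simp add: x_def r_def)
      qed
      then obtain T' e z where e: "e \<in> Cover T' T" "z \<in> Hom C T' (Dom C m)"
        and z: "\<And>i. 1 \<le> i \<Longrightarrow> i \<le> 2 \<Longrightarrow> r i \<cdot> z = r i \<cdot> (x i \<cdot> e)"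
        by blast
      note eH = CoverD(1)[OF e(1)]
      have "leg1 C X m \<cdot> z = a \<cdot> e"
        using z[of 1] comp_comp_eq[OF legs(1)[OF a] eH Hom_comp[OF a s(1)] mH(2)]
        by (simp add: r_def x_def)
      moreover have "leg2 C X m \<cdot> z = b \<cdot> e"
        using z[of 2] comp_comp_eq[OF legs(2)[OF b] eH Hom_comp[OF b s(1)] mH(3)]
        by (simp add: r_def x_def)
      ultimately have "rel m T' (a \<cdot> e) (b \<cdot> e)"
        using e(2) by (auto simp: rel_def)
      then show "rel m T a b"
        using rel_local[OF m a b e(1)] by blast
    qed
    then show ?thesis
      using uH(1) by blast
  qed
qed

text \<open>The kernel description serves twice: the first conclusion is the Mal'tsev property, and
  the second gives exactness because equivalence relations are reflexive.\<close>

lemma CRT2_reflexive: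
  assumes "CRT C 2" "reflexive_relation C X m"
  shows "equivalence_relation C X m" "effective C X m"
proof -
  obtain D u where "u \<in> Hom C X D"
      "\<And>T a b. rel m T a b \<longleftrightarrow> a \<in> Hom C T X \<and> b \<in> Hom C T X \<and> u \<cdot> a = u \<cdot> b"
    using CRT2_reflexive_kernel[OF assms] by blast
  with kernel_map_equivalence[of m u D] assms(2)
  show "equivalence_relation C X m" "effective C X m"
    by (simp_all add: reflexive_relation_def)
qed

text \<open>Dropping the monic part of the image factorization does not change the kernel
  pair.\<close>

lemma effective_cover:
  assumes "is_relation C X m" "effective C X m"
  shows "\<exists>D. \<exists>q \<in> Cover X D. \<forall>T a b.
    rel m T a b \<longleftrightarrow> a \<in> Hom C T X \<and> b \<in> Hom C T X \<and> q \<cdot> a = q \<cdot> b"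
proof -
  obtain f where f: "is_kernel_pair C f (Dom C m) (leg1 C X m) (leg2 C X m)"
    using assms(2) unfolding effective_def by blast
  then have fH: "f \<in> Hom C X (Cod C f)"
    using is_relation_Hom(2)[OF assms(1)] by (simp add: is_kernel_pair_def is_pullback_def Hom_def)
  have ker: "rel m T a b \<longleftrightarrow> a \<in> Hom C T X \<and> b \<in> Hom C T X \<and> f \<cdot> a = f \<cdot> b" for T a b
    using kernel_pair_iff[OF assms(1) fH] f by blast
  obtain I q j where q: "q \<in> Cover X I" and j: "monic C j" "j \<in> Hom C I (Cod C f)" "f = j \<cdot> q"
    using regular_mono_factorization[OF fH] by blast
  note qH = CoverD(1)[OF q]
  have "f \<cdot> a = f \<cdot> b \<longleftrightarrow> q \<cdot> a = q \<cdot> b" if ab: "a \<in> Hom C T X" "b \<in> Hom C T X" for T a b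
  proof -
    have "f \<cdot> a = j \<cdot> (q \<cdot> a)" "f \<cdot> b = j \<cdot> (q \<cdot> b)"
      using comp_comp_eq[OF j(3)[symmetric] _ qH j(2)] ab by simp_all
    moreover have "q \<cdot> a = q \<cdot> b" if "j \<cdot> (q \<cdot> a) = j \<cdot> (q \<cdot> b)"
      using monicD[OF j(1) that] ab[THEN Hom_comp[OF _ qH]] j(2) by (simp add: Hom_def)
    ultimately show ?thesis
      by metis
  qed
  with q ker show ?thesis
    by blast
qed

end


context regular
begin

text \<open>A cover is the coequalizer of its kernel pair, whose two projections are an instance of
  the elementwise hypothesis. Maps out of quotients are built with this.\<close>

lemma Cover_factor:
  assumes "q \<in> Cover X Y" "t \<in> Hom C X Z"
    "\<And>T a b. a \<in> Hom C T X \<Longrightarrow> b \<in> Hom C T X \<Longrightarrow> q \<cdot> a = q \<cdot> b \<Longrightarrow> t \<cdot> a = t \<cdot> b"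
  shows "\<exists>h \<in> Hom C Y Z. h \<cdot> q = t"
proof -
  note qH = CoverD(1)[OF assms(1)]
  obtain K k l where P: "is_pullback C q q K k l"
    using pullback_exists[OF finitely_complete qH qH] by blast
  note kl = pullback_Hom[OF P qH qH]
  show ?thesis
    using coequalizer_lift[OF Cover_coequalizer[OF assms(1) P] kl(1) assms(2) _ qH] assms(3)[OF kl]
    by blast
qed

end

context regular_object
begin

text \<open>The composite is represented by a relation, so it inherits restriction along maps, and
  in the next lemma descent along covers, from \<open>rel\<close>.\<close>

lemma rcomp_comp:
  assumes "is_relation C X m" "is_relation C X n" "rcomp m n T a b" "e \<in> Hom C T' T"
  shows "rcomp m n T' (a \<cdot> e) (b \<cdot> e)"
  using composite_relation[OF assms(1,2)] rel_comp assms(3,4) by blast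

lemma rcomp_local:
  assumes "is_relation C X m" "is_relation C X n" "a \<in> Hom C T X" "b \<in> Hom C T X" "e \<in> Cover T' T"
    "rcomp m n T' (a \<cdot> e) (b \<cdot> e)"
  shows "rcomp m n T a b"
  using composite_relation[OF assms(1,2)] rel_local[OF _ assms(3-5)] assms(6) by blast

lemma rcompI:
  assumes "is_relation C X m" "is_relation C X n" "rel m T a y" "rel n T y b"
  shows "rcomp m n T a b"
proof -
  have ab: "a \<in> Hom C T X" "b \<in> Hom C T X"
    using rel_Hom[OF assms(1,3)] rel_Hom[OF assms(2,4)] by blast+
  then have "a \<cdot> Ident C T = a" "b \<cdot> Ident C T = b" "T \<in> Obj C"
    using Comp_Ident Hom_Obj(1) by blast+
  then show ?thesis
    using ab assms(3,4) Cover_Ident unfolding rcomp_def by metis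
qed

text \<open>The two values agree with that of the middle element over a cover, and the cover
  cancels. Hence a map that identifies related pairs of both factors also does so for their
  composite.\<close>

lemma rcomp_equalized:
  assumes "w \<in> Hom C X D" "rcomp m n T a b" "is_relation C X m"
    "\<And>T a b. rel m T a b \<Longrightarrow> w \<cdot> a = w \<cdot> b" "\<And>T a b. rel n T a b \<Longrightarrow> w \<cdot> a = w \<cdot> b"
  shows "w \<cdot> a = w \<cdot> b"
proof -
  obtain T' e y where e: "a \<in> Hom C T X" "b \<in> Hom C T X" "e \<in> Cover T' T" "rel m T' (a \<cdot> e) y"
      "rel n T' y (b \<cdot> e)"
    using assms(2) by (auto simp: rcomp_def)
  note eH = CoverD(1)[OF e(3)]
  have "w \<cdot> (a \<cdot> e) = w \<cdot> (b \<cdot> e)"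
    using assms(4)[OF e(4)] assms(5)[OF e(5)] by simp
  then have "(w \<cdot> a) \<cdot> e = (w \<cdot> b) \<cdot> e"
    using comp_comp_eq[OF refl eH e(1) assms(1)] comp_comp_eq[OF refl eH e(2) assms(1)] by simp
  then show ?thesis
    by (rule Cover_cancel[OF e(3) Hom_comp[OF e(1) assms(1)] Hom_comp[OF e(2) assms(1)]])
qed

end

context maltsev_object
begin

text \<open>The remainder problem \<open>z \<equiv> a\<close> modulo \<open>k\<close>, \<open>z \<equiv> a\<close> modulo \<open>m\<close>, \<open>z \<equiv> b\<close> modulo \<open>n\<close> is
  compatible when \<open>(a, b)\<close> lies in \<open>k \<and> (m \<or> n)\<close>, and a solution \<open>z\<close> puts \<open>(a, b)\<close> in
  \<open>(k \<and> m) \<or> (k \<and> n)\<close>.\<close>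

lemma CRT3_distributive:
  assumes "CRT C 3" "\<And>m. equivalence_relation C X m \<Longrightarrow> effective C X m"
  shows "distributive_lattice (Equiv C X)"
  unfolding distributive_lattice_Equiv_iff
proof (intro allI impI, elim conjE)
  fix k m n T a b
  assume k: "equivalence_relation C X k" and m: "equivalence_relation C X m"
    and n: "equivalence_relation C X n" and kab: "rel k T a b" and mnab: "rcomp m n T a b"
  note kR = equivalence_relationD(1)[OF k] and mR = equivalence_relationD(1)[OF m]
    and nR = equivalence_relationD(1)[OF n]
  note ab = rel_Hom[OF kR kab]
  obtain K f where f: "f \<in> Cover X K"
    and kf: "\<And>T a b. rel k T a b \<longleftrightarrow> a \<in> Hom C T X \<and> b \<in> Hom C T X \<and> f \<cdot> a = f \<cdot> b"
    using effective_cover[OF kR assms(2)[OF k]] by blast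
  obtain M g where g: "g \<in> Cover X M"
    and mg: "\<And>T a b. rel m T a b \<longleftrightarrow> a \<in> Hom C T X \<and> b \<in> Hom C T X \<and> g \<cdot> a = g \<cdot> b"
    using effective_cover[OF mR assms(2)[OF m]] by blast
  obtain N h where h: "h \<in> Cover X N"
    and nh: "\<And>T a b. rel n T a b \<longleftrightarrow> a \<in> Hom C T X \<and> b \<in> Hom C T X \<and> h \<cdot> a = h \<cdot> b"
    using effective_cover[OF nR assms(2)[OF n]] by blast
  define r where "r i = (if i = 1 then f else if i = 2 then g else h)" for i :: nat
  \<comment> \<open>The right hand sides \<open>a\<close>, \<open>a\<close>, \<open>b\<close> belong
    to the moduli \<open>k\<close>, \<open>m\<close>, \<open>n\<close> in this order.\<close>
  define x where "x i = (if i = 3 then b else a)" for i :: nat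
  have cov: "r i \<in> Cover X (Cod C (r i))" for i
    using f g h by (auto simp: r_def Cover_def Hom_def)
  show "\<exists>T' e y. e \<in> Cover T' T \<and> (rel k T' (a \<cdot> e) y \<and> rel m T' (a \<cdot> e) y) \<and>
          rel k T' y (b \<cdot> e) \<and> rel n T' y (b \<cdot> e)"
  proof (rule CRT_solve[OF assms(1) one_le_numeral cov])
    fix D u v
    assume push:
      "\<And>i j. 1 \<le> i \<Longrightarrow> i < j \<Longrightarrow> j \<le> 3 \<Longrightarrow> is_pushout C (r i) (r j) (D i j) (u i j) (v i j)"
      and solve: "\<And>T x. T \<in> Obj C \<Longrightarrow> (\<And>i. 1 \<le> i \<Longrightarrow> i \<le> 3 \<Longrightarrow> x i \<in> Hom C T X) \<Longrightarrow>
        (\<And>i j. 1 \<le> i \<Longrightarrow> i < j \<Longrightarrow> j \<le> 3 \<Longrightarrow> u i j \<cdot> (r i \<cdot> x i) = u i j \<cdot> (r i \<cdot> x j)) \<Longrightarrow>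
      \<exists>T' e z. e \<in> Cover T' T \<and> z \<in> Hom C T' X \<and>
        (\<forall>i. 1 \<le> i \<and> i \<le> 3 \<longrightarrow> r i \<cdot> z = r i \<cdot> (x i \<cdot> e))"
    have "is_pushout C g h (D 2 3) (u 2 3) (v 2 3)"
      using push[of 2 3] by (simp add: r_def)
    note uv = pushout_Hom[OF this CoverD(1)[OF g] CoverD(1)[OF h]]
    note wH = Hom_comp[OF CoverD(1)[OF g] uv(1)]
    \<comment> \<open>The map into the pushout of \<open>g\<close> and \<open>h\<close> identifies
      related pairs of \<open>m\<close> through \<open>g\<close> and of \<open>n\<close> through
      \<open>h\<close>, hence those of the composite.\<close>
    have "(u 2 3 \<cdot> g) \<cdot> a = (u 2 3 \<cdot> g) \<cdot> b"
    proof (rule rcomp_equalized[OF wH mnab mR])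
      fix T a b
      show "(u 2 3 \<cdot> g) \<cdot> a = (u 2 3 \<cdot> g) \<cdot> b" if "rel m T a b"
        using that comp_comp_eq[OF refl _ CoverD(1)[OF g] uv(1)] unfolding mg by metis
      show "(u 2 3 \<cdot> g) \<cdot> a = (u 2 3 \<cdot> g) \<cdot> b" if "rel n T a b"
        using that comp_comp_eq[OF refl _ CoverD(1)[OF h] uv(2)] unfolding nh uv(3) by metis
    qed
    then have u23: "u 2 3 \<cdot> (g \<cdot> a) = u 2 3 \<cdot> (g \<cdot> b)"
      using comp_comp_eq[OF refl ab(1) CoverD(1)[OF g] uv(1)]
        comp_comp_eq[OF refl ab(2) CoverD(1)[OF g] uv(1)] by simp
    have "\<exists>T' e z. e \<in> Cover T' T \<and> z \<in> Hom C T' X \<and>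
        (\<forall>i. 1 \<le> i \<and> i \<le> 3 \<longrightarrow> r i \<cdot> z = r i \<cdot> (x i \<cdot> e))"
    proof (rule solve)
      show "T \<in> Obj C"
        using Hom_Obj(1)[OF ab(1)] .
      show "x i \<in> Hom C T X" for i
        using ab by (simp add: x_def)
      fix i j :: nat assume "1 \<le> i" "i < j" "j \<le> 3"
      \<comment> \<open>The first pair has equal right hand sides, the second is compatible because
        \<open>k\<close> relates \<open>a\<close> and \<open>b\<close>, and the third is
        \<open>u23\<close>.\<close>
      then consider "i = 1" "j = 2" | "i = 1" "j = 3" | "i = 2" "j = 3"
        by linarith
      then show "u i j \<cdot> (r i \<cdot> x i) = u i j \<cdot> (r i \<cdot> x j)"
        using u23 kab by cases (simp_all add: x_def r_def kf)
    qed
    then obtain T' e z where e: "e \<in> Cover T' T" "z \<in> Hom C T' X"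
      and z: "\<And>i. 1 \<le> i \<Longrightarrow> i \<le> 3 \<Longrightarrow> r i \<cdot> z = r i \<cdot> (x i \<cdot> e)"
      by blast
    note eH = CoverD(1)[OF e(1)]
    have sol: "rel k T' (a \<cdot> e) z" "rel m T' (a \<cdot> e) z" "rel n T' z (b \<cdot> e)"
      using z[of 1] z[of 2] z[of 3] e(2) ab[THEN Hom_comp[OF eH]]
      unfolding kf mg nh by (simp_all add: r_def x_def)
    \<comment> \<open>\<open>z\<close> is a solution modulo \<open>k\<close> for \<open>a\<close>,
      and \<open>k\<close> relates \<open>a\<close> to \<open>b\<close>.\<close>
    moreover have "rel k T' z (b \<cdot> e)"
      using equivalence_relationD(3,4)[OF k] sol(1) rel_comp[OF kR kab eH] by blast
    ultimately show ?thesis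
      using e(1) by blast
  qed
qed

end



section \<open>Chinese remainders in arithmetical categories\<close>

locale arithmetical_object = maltsev_object +
  assumes effective: "equivalence_relation C X m \<Longrightarrow> effective C X m"
    and distributive: "distributive_lattice (Equiv C X)"
begin

text \<open>A map out of \<open>X\<close> equalizes the composite iff it equalizes both kernels,
  that is, iff it factors through \<open>f\<close> and through \<open>g\<close>. So the quotient by
  the composite is the pushout, and effectiveness of the composite bounds the kernel of
  \<open>u \<cdot> f\<close> by it.\<close>

lemma pushout_of_covers:
  assumes f: "f \<in> Cover X Y" and g: "g \<in> Cover X Z"
    and m: "equivalence_relation C X m" and n: "equivalence_relation C X n"
    and mf: "\<And>T a b. rel m T a b \<longleftrightarrow> a \<in> Hom C T X \<and> b \<in> Hom C T X \<and> f \<cdot> a = f \<cdot> b"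
    and ng: "\<And>T a b. rel n T a b \<longleftrightarrow> a \<in> Hom C T X \<and> b \<in> Hom C T X \<and> g \<cdot> a = g \<cdot> b"
  shows "\<exists>D u v. is_pushout C f g D u v \<and>
    (\<forall>T. \<forall>a \<in> Hom C T X. \<forall>b \<in> Hom C T X. u \<cdot> (f \<cdot> a) = u \<cdot> (f \<cdot> b) \<longrightarrow> rcomp m n T a b)"
proof -
  note fH = CoverD(1)[OF f] and gH = CoverD(1)[OF g]
  note mR = equivalence_relationD(1)[OF m] and nR = equivalence_relationD(1)[OF n]
  obtain c where c: "equivalence_relation C X c" and cc: "\<And>T a b. rel c T a b \<longleftrightarrow> rcomp m n T a b"
    using equivalence_composite[OF m n] by blast
  obtain D p where p: "p \<in> Cover X D"
    and cp: "\<And>T a b. rel c T a b \<longleftrightarrow> a \<in> Hom C T X \<and> b \<in> Hom C T X \<and> p \<cdot> a = p \<cdot> b"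
    using effective_cover[OF equivalence_relationD(1)[OF c] effective[OF c]] by blast
  note pH = CoverD(1)[OF p]
  obtain u where u: "u \<in> Hom C Y D" "u \<cdot> f = p"
    using Cover_factor[OF f pH] rcomp_left[OF mR n] unfolding mf cc[symmetric] cp by blast
  obtain v where v: "v \<in> Hom C Z D" "v \<cdot> g = p"
    using Cover_factor[OF g pH] rcomp_right[OF m nR] unfolding ng cc[symmetric] cp by blast
  have "\<exists>!h. h \<in> Hom C D W \<and> h \<cdot> u = a \<and> h \<cdot> v = b"
    if a: "a \<in> Hom C Y W" and b: "b \<in> Hom C Z W" and eq: "a \<cdot> f = b \<cdot> g" for W a b
  proof -
    note aH = Hom_comp[OF fH a]
    obtain h where h: "h \<in> Hom C D W" "h \<cdot> p = a \<cdot> f"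
    proof -
      have "(a \<cdot> f) \<cdot> x = (a \<cdot> f) \<cdot> y" if "rcomp m n T x y" for T x y
      proof (rule rcomp_equalized[OF aH that mR])
        fix T x y
        show "(a \<cdot> f) \<cdot> x = (a \<cdot> f) \<cdot> y" if "rel m T x y"
          using that comp_comp_eq[OF refl _ fH a] unfolding mf by metis
        show "(a \<cdot> f) \<cdot> x = (a \<cdot> f) \<cdot> y" if "rel n T x y"
          using that comp_comp_eq[OF refl _ gH b] unfolding ng eq by metis
      qed
      then show ?thesis
        using Cover_factor[OF p aH] that unfolding cc[symmetric] cp by blast
    qed
    have hu: "h \<cdot> u = a"
      using Cover_cancel[OF f Hom_comp[OF u(1) h(1)] a] comp_comp_eq[OF refl fH u(1) h(1)] u(2) h(2)
      by simp
    have hv: "h \<cdot> v = b"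
      using Cover_cancel[OF g Hom_comp[OF v(1) h(1)] b] comp_comp_eq[OF refl gH v(1) h(1)] v(2) h(2) eq
      by simp
    have "k = h" if k: "k \<in> Hom C D W" "k \<cdot> u = a" for k
      using Cover_cancel[OF p k(1) h(1)] comp_comp_eq[OF k(2) fH u(1) k(1)] u(2) h(2) by simp
    then show ?thesis
      using h(1) hu hv by blast
  qed
  then have "is_pushout C f g D u v"
    using fH gH u v unfolding is_pushout_def by (simp add: Hom_def)
  moreover have "rcomp m n T a b"
    if "a \<in> Hom C T X" "b \<in> Hom C T X" "u \<cdot> (f \<cdot> a) = u \<cdot> (f \<cdot> b)" for T a b
    using that comp_comp_eq[OF u(2) that(1) fH u(1)] comp_comp_eq[OF u(2) that(2) fH u(1)] cp cc
    by simp
  ultimately show ?thesis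
    by blast
qed

text \<open>Dual distributivity \<open>(k \<or> n) \<and> (m \<or> n) \<le> (k \<and> m) \<or> n\<close>: a pair related by both joins gives
  elements \<open>y\<close> and \<open>w\<close> with \<open>a k y\<close>, \<open>a m w\<close> that are related by \<open>n \<and> (k \<or> m)\<close>.\<close>

lemma rcomp_intersection:
  assumes k: "equivalence_relation C X k" and m: "equivalence_relation C X m"
    and n: "equivalence_relation C X n"
    and c: "is_relation C X c" "\<And>T a b. rel c T a b \<longleftrightarrow> rel k T a b \<and> rel m T a b"
    and kn: "rcomp k n T a b" and mn: "rcomp m n T a b"
  shows "rcomp c n T a b"
proof -
  note kR = equivalence_relationD(1)[OF k] and mR = equivalence_relationD(1)[OF m]
    and nR = equivalence_relationD(1)[OF n]
  obtain T1 d y where d: "a \<in> Hom C T X" "b \<in> Hom C T X" "d \<in> Cover T1 T"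
      and y: "rel k T1 (a \<cdot> d) y" "rel n T1 y (b \<cdot> d)"
    using kn by (auto simp: rcomp_def)
  note dH = CoverD(1)[OF d(3)]
  obtain T2 e w where e: "e \<in> Cover T2 T1"
      and w: "rel m T2 ((a \<cdot> d) \<cdot> e) w" "rel n T2 w ((b \<cdot> d) \<cdot> e)"
    using rcomp_comp[OF mR nR mn dH] unfolding rcomp_def by blast
  note eH = CoverD(1)[OF e]
  note ye = rel_comp[OF kR y(1) eH] rel_comp[OF nR y(2) eH]
  \<comment> \<open>Both elements are related to \<open>b\<close> by \<open>n\<close>, and
    \<open>a\<close> is a middle element that joins them through \<open>k\<close> and
    \<open>m\<close>.\<close>
  have "rel n T2 (y \<cdot> e) w"
    using ye w equivalence_relationD(3,4)[OF n] by blast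
  moreover have "rcomp k m T2 (y \<cdot> e) w"
    using rcompI[OF kR mR equivalence_relationD(3)[OF k ye(1)] w(1)] .
  \<comment> \<open>Distributivity with \<open>n\<close> as the relation that is met: the middle
    element \<open>z\<close> is related to \<open>a\<close> by \<open>k\<close> through
    \<open>y\<close>, to \<open>a\<close> by \<open>m\<close> through \<open>w\<close>, and to
    \<open>b\<close> by \<open>n\<close>.\<close>
  ultimately obtain T3 g z where g: "g \<in> Cover T3 T2"
      and z: "rel n T3 ((y \<cdot> e) \<cdot> g) z" "rel k T3 ((y \<cdot> e) \<cdot> g) z" "rel m T3 z (w \<cdot> g)"
        "rel n T3 z (w \<cdot> g)"
    using distributive n k m unfolding distributive_lattice_Equiv_iff by blast
  note gH = CoverD(1)[OF g]
  have "rel k T3 (((a \<cdot> d) \<cdot> e) \<cdot> g) z"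
    using equivalence_relationD(4)[OF k rel_comp[OF kR ye(1) gH] z(2)] .
  moreover have "rel m T3 (((a \<cdot> d) \<cdot> e) \<cdot> g) z"
    using equivalence_relationD(4)[OF m rel_comp[OF mR w(1) gH] equivalence_relationD(3)[OF m z(3)]] .
  moreover have "rel n T3 z (((b \<cdot> d) \<cdot> e) \<cdot> g)"
    using equivalence_relationD(4)[OF n z(4) rel_comp[OF nR w(2) gH]] .
  ultimately have "rcomp c n T3 (((a \<cdot> d) \<cdot> e) \<cdot> g) (((b \<cdot> d) \<cdot> e) \<cdot> g)"
    using rcompI[OF c(1) nR] c(2) by blast
  \<comment> \<open>The three covers \<open>g\<close>, \<open>e\<close> and \<open>d\<close> are
    removed one after the other.\<close>
  then show ?thesis
    using rcomp_local[OF c(1) nR] d(1,2) dH eH g e d(3) by (meson Hom_comp)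
qed

text \<open>Iterating \<open>rcomp_intersection\<close> gives dual distributivity for finite
  families: the meet of the joins with \<open>\<phi>\<close> lies below the join of
  \<open>\<phi>\<close> with the meet. The quantifier over \<open>\<phi>\<close> is inside, so that
  one \<open>\<psi>\<close> serves every \<open>\<phi>\<close>.\<close>

lemma equivalence_finite_intersection:
  assumes "finite I" "I \<noteq> {}" "\<And>i. i \<in> I \<Longrightarrow> equivalence_relation C X (\<theta> i)"
  shows "\<exists>\<psi>. equivalence_relation C X \<psi> \<and> (\<forall>T a b. rel \<psi> T a b \<longleftrightarrow> (\<forall>i\<in>I. rel (\<theta> i) T a b)) \<and>
    (\<forall>\<phi> T a b. equivalence_relation C X \<phi> \<longrightarrow> (\<forall>i\<in>I. rcomp (\<theta> i) \<phi> T a b) \<longrightarrow> rcomp \<psi> \<phi> T a b)"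
  using assms
proof (induction I rule: finite_ne_induct)
  case (singleton i)
  then show ?case
    by (intro exI[of _ "\<theta> i"]) simp
next
  case (insert i I)
  have "\<exists>\<psi>. equivalence_relation C X \<psi> \<and> (\<forall>T a b. rel \<psi> T a b \<longleftrightarrow> (\<forall>i\<in>I. rel (\<theta> i) T a b)) \<and>
    (\<forall>\<phi> T a b. equivalence_relation C X \<phi> \<longrightarrow> (\<forall>i\<in>I. rcomp (\<theta> i) \<phi> T a b) \<longrightarrow> rcomp \<psi> \<phi> T a b)"
    by (rule insert.IH) (simp add: insert.prems)
  then obtain \<psi> where \<psi>: "equivalence_relation C X \<psi>"
    and rel_\<psi>: "\<forall>T a b. rel \<psi> T a b \<longleftrightarrow> (\<forall>i\<in>I. rel (\<theta> i) T a b)"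
    and rcomp_\<psi>: "\<forall>\<phi> T a b. equivalence_relation C X \<phi> \<longrightarrow> (\<forall>i\<in>I. rcomp (\<theta> i) \<phi> T a b) \<longrightarrow>
      rcomp \<psi> \<phi> T a b"
    by blast
  have \<theta>: "equivalence_relation C X (\<theta> i)"
    using insert.prems by simp
  obtain c where c: "equivalence_relation C X c"
      "\<And>T a b. rel c T a b \<longleftrightarrow> rel (\<theta> i) T a b \<and> rel \<psi> T a b"
    using equivalence_intersection[OF \<theta> \<psi>] by blast
  have "rcomp c \<phi> T a b"
    if "equivalence_relation C X \<phi>" "\<forall>j\<in>insert i I. rcomp (\<theta> j) \<phi> T a b" for \<phi> T a b
    using rcomp_intersection[OF \<theta> \<psi> that(1) equivalence_relationD(1)[OF c(1)] c(2)]
      rcomp_\<psi> that by blast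
  with c rel_\<psi> show ?case
    by (intro exI[of _ c]) simp
qed

text \<open>Let \<open>z\<close> solve the first \<open>k\<close> congruences. For each of them,
  \<open>z\<close> is congruent to \<open>x i\<close>, which is joined to the next right hand side
  through \<open>\<theta> i\<close> and the next modulus. Finite dual distributivity then joins
  \<open>z\<close> to that right hand side through the intersection of the old moduli, and the
  middle element is the new solution. The bound \<open>k\<close> is separate from \<open>n\<close>
  so that the family stays fixed during the induction.\<close>

lemma simultaneous_congruences:
  fixes k n :: nat
  assumes "\<And>i. 1 \<le> i \<Longrightarrow> i \<le> n \<Longrightarrow> equivalence_relation C X (\<theta> i)"
    and "\<And>i. 1 \<le> i \<Longrightarrow> i \<le> n \<Longrightarrow> x i \<in> Hom C T X"
    and "\<And>i j. 1 \<le> i \<Longrightarrow> i < j \<Longrightarrow> j \<le> n \<Longrightarrow> rcomp (\<theta> i) (\<theta> j) T (x i) (x j)"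
    and "1 \<le> k" "k \<le> n"
  shows "\<exists>T' e z. e \<in> Cover T' T \<and> z \<in> Hom C T' X \<and>
    (\<forall>i. 1 \<le> i \<and> i \<le> k \<longrightarrow> rel (\<theta> i) T' z (x i \<cdot> e))"
  using assms(4,5)
proof (induction k rule: nat_induct_at_least)
  case base
  note x = assms(2)[OF order_refl base]
  have id: "x 1 \<cdot> Ident C T = x 1" "rel (\<theta> 1) T (x 1) (x 1)"
    using Comp_Ident[OF x] equivalence_relationD(2)[OF assms(1)[OF order_refl base] x] .
  have "\<forall>i. 1 \<le> i \<and> i \<le> 1 \<longrightarrow> rel (\<theta> i) T (x 1) (x i \<cdot> Ident C T)"
    using id by (metis antisym)
  then show ?case
    using Cover_Ident[OF Hom_Obj(1)[OF x]] x by blast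
next
  case (Suc k)
  then obtain T' e z where e: "e \<in> Cover T' T" and z: "z \<in> Hom C T' X"
    and rel_z: "\<And>i. 1 \<le> i \<Longrightarrow> i \<le> k \<Longrightarrow> rel (\<theta> i) T' z (x i \<cdot> e)"
    by auto
  note eH = CoverD(1)[OF e]
  let ?\<phi> = "\<theta> (Suc k)"
  have eqv: "equivalence_relation C X (\<theta> i)" if "i \<in> {1..k}" for i
    using assms(1) that Suc.prems by simp
  have \<phi>: "equivalence_relation C X ?\<phi>" and xk: "x (Suc k) \<in> Hom C T X"
    using assms(1,2) Suc.prems by simp_all
  note \<phi>R = equivalence_relationD(1)[OF \<phi>]
  obtain \<psi> where \<psi>: "equivalence_relation C X \<psi>"
    and rel_\<psi>: "\<forall>T a b. rel \<psi> T a b \<longleftrightarrow> (\<forall>i\<in>{1..k}. rel (\<theta> i) T a b)"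
    and rcomp_\<psi>: "\<forall>\<phi> T a b. equivalence_relation C X \<phi> \<longrightarrow> (\<forall>i\<in>{1..k}. rcomp (\<theta> i) \<phi> T a b) \<longrightarrow>
      rcomp \<psi> \<phi> T a b"
    using equivalence_finite_intersection[where I = "{1..k}" and \<theta> = \<theta>,
        OF finite_atLeastAtMost _ eqv] Suc.hyps by auto
  \<comment> \<open>The middle element of the hypothesis for \<open>x i\<close> also works for
    \<open>z\<close>, by transitivity of \<open>\<theta> i\<close>.\<close>
  have "rcomp (\<theta> i) ?\<phi> T' z (x (Suc k) \<cdot> e)" if i: "i \<in> {1..k}" for i
  proof -
    note \<theta> = eqv[OF i]
    note \<theta>R = equivalence_relationD(1)[OF \<theta>]
    have "rcomp (\<theta> i) ?\<phi> T' (x i \<cdot> e) (x (Suc k) \<cdot> e)"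
      using rcomp_comp[OF \<theta>R \<phi>R assms(3) eH] i Suc.prems by simp
    then obtain S d y where d: "d \<in> Cover S T'" "x (Suc k) \<cdot> e \<in> Hom C T' X"
        and y: "rel (\<theta> i) S ((x i \<cdot> e) \<cdot> d) y" "rel ?\<phi> S y ((x (Suc k) \<cdot> e) \<cdot> d)"
      unfolding rcomp_def by blast
    have "rel (\<theta> i) S (z \<cdot> d) y"
      using equivalence_relationD(4)[OF \<theta> rel_comp[OF \<theta>R rel_z CoverD(1)[OF d(1)]] y(1)] i by simp
    with d y z show ?thesis
      unfolding rcomp_def by blast
  qed
  then have "rcomp \<psi> ?\<phi> T' z (x (Suc k) \<cdot> e)"
    using rcomp_\<psi> \<phi> by blast
  then obtain S d y where d: "d \<in> Cover S T'"
      and y: "rel \<psi> S (z \<cdot> d) y" "rel ?\<phi> S y ((x (Suc k) \<cdot> e) \<cdot> d)"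
    unfolding rcomp_def by blast
  note dH = CoverD(1)[OF d]
  have assoc: "(x i \<cdot> e) \<cdot> d = x i \<cdot> (e \<cdot> d)" if "1 \<le> i" "i \<le> Suc k" for i
    using comp_comp_eq[OF refl dH eH assms(2)] that Suc.prems by simp
  \<comment> \<open>Passing from \<open>z\<close> to \<open>y\<close> changes nothing modulo the old
    moduli, since the two are related by their intersection.\<close>
  have "rel (\<theta> i) S y (x i \<cdot> (e \<cdot> d))" if i: "1 \<le> i" "i \<le> Suc k" for i
  proof (cases "i = Suc k")
    case True
    then show ?thesis
      using y(2) assoc[OF i] by simp
  next
    case False
    with i have ik: "i \<in> {1..k}" "i \<le> k"
      by auto
    have "rel (\<theta> i) S (z \<cdot> d) y"
      using y(1) ik(1) rel_\<psi> by blast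
    moreover have "rel (\<theta> i) S (z \<cdot> d) ((x i \<cdot> e) \<cdot> d)"
      using rel_comp[OF equivalence_relationD(1)[OF eqv[OF ik(1)]] rel_z[OF i(1) ik(2)] dH] .
    ultimately show ?thesis
      using equivalence_relationD(3,4)[OF eqv[OF ik(1)]] assoc[OF i] by metis
  qed
  then show ?case
    using Cover_comp[OF d e] rel_Hom(1)[OF \<phi>R y(2)] by blast
qed

end

context regular
begin

section \<open>The two implications between arithmeticity and remainders\<close>

lemma arithmetical_object_iff:
  assumes "X \<in> Obj C"
  shows "arithmetical_object C X \<longleftrightarrow> maltsev_category C \<and>
    (\<forall>m. equivalence_relation C X m \<longrightarrow> effective C X m) \<and> distributive_lattice (Equiv C X)"
  using assms regular_axioms
  by (auto simp: arithmetical_object_def arithmetical_object_axioms_def maltsev_object_def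
      maltsev_object_axioms_def regular_object_def regular_object_axioms_def)

lemma exact_arithmetical_CRT:
  assumes "exact_arithmetical_category C" "1 \<le> n"
  shows "CRT C n"
  unfolding CRT_def
proof (rule allI, rule allI, rule impI)
  fix X r
  assume fam: "\<forall>i. 1 \<le> i \<and> i \<le> n \<longrightarrow> regular_epi C (r i) \<and> Dom C (r i) = X"
  have r: "r i \<in> Cover X (Cod C (r i))" if "1 \<le> i" "i \<le> n" for i
    using fam that by (auto simp: Cover_def Hom_def regular_epi_def is_coequalizer_def)
  note rH = CoverD(1)[OF r]
  have X: "X \<in> Obj C"
    using Hom_Obj(1)[OF rH[OF order_refl assms(2)]] .
  interpret arithmetical_object C X
    using assms(1) X unfolding arithmetical_object_iff[OF X]
    by (simp add: exact_arithmetical_category_def exact_category_def)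
  have "\<exists>\<theta>. \<forall>i. 1 \<le> i \<and> i \<le> n \<longrightarrow> equivalence_relation C X (\<theta> i) \<and>
      (\<forall>T a b. rel (\<theta> i) T a b \<longleftrightarrow> a \<in> Hom C T X \<and> b \<in> Hom C T X \<and> r i \<cdot> a = r i \<cdot> b)"
    using kernel_equivalence[OF rH] by (intro choice) blast
  then obtain \<theta> where \<theta>: "\<And>i. 1 \<le> i \<Longrightarrow> i \<le> n \<Longrightarrow> equivalence_relation C X (\<theta> i)"
    and rel_\<theta>: "\<And>i T a b. 1 \<le> i \<Longrightarrow> i \<le> n \<Longrightarrow>
      rel (\<theta> i) T a b \<longleftrightarrow> a \<in> Hom C T X \<and> b \<in> Hom C T X \<and> r i \<cdot> a = r i \<cdot> b"
    by blast
  have pushout: "\<exists>D u v. is_pushout C (r i) (r j) D u v \<and> (\<forall>T. \<forall>a \<in> Hom C T X. \<forall>b \<in> Hom C T X.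
      u \<cdot> (r i \<cdot> a) = u \<cdot> (r i \<cdot> b) \<longrightarrow> rcomp (\<theta> i) (\<theta> j) T a b)"
    if ij: "1 \<le> i" "i < j" "j \<le> n" for i j
  proof -
    have i: "1 \<le> i" "i \<le> n" and j: "1 \<le> j" "j \<le> n"
      using ij by auto
    show ?thesis
      by (rule pushout_of_covers[OF r[OF i] r[OF j] \<theta>[OF i] \<theta>[OF j] rel_\<theta>[OF i] rel_\<theta>[OF j]])
  qed
  show "(\<forall>i j. 1 \<le> i \<and> i < j \<and> j \<le> n \<longrightarrow> (\<exists>D u v. is_pushout C (r i) (r j) D u v)) \<and>
      (\<forall>D u v L p. (\<forall>i j. 1 \<le> i \<and> i < j \<and> j \<le> n \<longrightarrow>
          is_pushout C (r i) (r j) (D i j) (u i j) (v i j)) \<and>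
        is_limit C (crt_diagram C n r D u v) L p \<longrightarrow>
        regular_epi C (comparison C (crt_diagram C n r D u v) X (crt_cone C r u) L p))"
  proof (intro conjI allI impI, elim conjE)
    show "\<exists>D u v. is_pushout C (r i) (r j) D u v" if "1 \<le> i" "i < j" "j \<le> n" for i j
      using pushout[OF that] by blast
    fix D u v L p
    assume "(\<forall>i j. 1 \<le> i \<and> i < j \<and> j \<le> n \<longrightarrow>
          is_pushout C (r i) (r j) (D i j) (u i j) (v i j)) \<and>
        is_limit C (crt_diagram C n r D u v) L p"
    then have push: "\<And>i j. 1 \<le> i \<Longrightarrow> i < j \<Longrightarrow> j \<le> n \<Longrightarrow>
          is_pushout C (r i) (r j) (D i j) (u i j) (v i j)"
      and L: "is_limit C (crt_diagram C n r D u v) L p"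
      by blast+
    \<comment> \<open>\<open>CRT\<close> concerns arbitrary pushouts, while the bound on the kernel
      is known for the constructed one. The map from the given pushout to the constructed one
      carries the equation across.\<close>
    have compat: "rcomp (\<theta> i) (\<theta> j) T a b"
      if ij: "1 \<le> i" "i < j" "j \<le> n" and ab: "a \<in> Hom C T X" "b \<in> Hom C T X"
        and eq: "u i j \<cdot> (r i \<cdot> a) = u i j \<cdot> (r i \<cdot> b)" for i j T a b
    proof -
      have i: "1 \<le> i" "i \<le> n" and j: "1 \<le> j" "j \<le> n"
        using ij by auto
      obtain E s t where st: "is_pushout C (r i) (r j) E s t"
        and s: "\<forall>T. \<forall>a \<in> Hom C T X. \<forall>b \<in> Hom C T X.
          s \<cdot> (r i \<cdot> a) = s \<cdot> (r i \<cdot> b) \<longrightarrow> rcomp (\<theta> i) (\<theta> j) T a b"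
        using pushout[OF ij] by blast
      note st = pushout_Hom[OF st rH[OF i] rH[OF j]]
      note uH = pushout_Hom(1)[OF push[OF ij] rH[OF i] rH[OF j]]
      obtain h where h: "h \<in> Hom C (D i j) E" "h \<cdot> u i j = s"
        using pushout_lift[OF push[OF ij] rH[OF i] rH[OF j] st] by blast
      have "s \<cdot> (r i \<cdot> a) = s \<cdot> (r i \<cdot> b)"
        using comp_comp_eq[OF h(2) Hom_comp[OF ab(1) rH[OF i]] uH h(1)]
          comp_comp_eq[OF h(2) Hom_comp[OF ab(2) rH[OF i]] uH h(1)] eq by simp
      with s ab show ?thesis
        by blast
    qed
    show "regular_epi C (comparison C (crt_diagram C n r D u v) X (crt_cone C r u) L p)"
    proof (rule comparison_regular_epi_iff[THEN iffD2, OF X r push L]; (intro allI impI, elim conjE)?)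
      fix T x
      assume x: "\<forall>i. 1 \<le> i \<and> i \<le> n \<longrightarrow> x i \<in> Hom C T X"
        and eq: "\<forall>i j. 1 \<le> i \<and> i < j \<and> j \<le> n \<longrightarrow> u i j \<cdot> (r i \<cdot> x i) = u i j \<cdot> (r i \<cdot> x j)"
      have xH: "x i \<in> Hom C T X" if "1 \<le> i" "i \<le> n" for i
        using x that by blast
      have xx: "rcomp (\<theta> i) (\<theta> j) T (x i) (x j)" if ij: "1 \<le> i" "i < j" "j \<le> n" for i j
        using compat[OF ij xH xH eq[rule_format]] ij by simp
      have "\<exists>T' e z. e \<in> Cover T' T \<and> z \<in> Hom C T' X \<and>
          (\<forall>i. 1 \<le> i \<and> i \<le> n \<longrightarrow> rel (\<theta> i) T' z (x i \<cdot> e))"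
        by (rule simultaneous_congruences[OF \<theta> xH xx assms(2) order_refl])
      then show "\<exists>T' e z. e \<in> Cover T' T \<and> z \<in> Hom C T' X \<and>
          (\<forall>i. 1 \<le> i \<and> i \<le> n \<longrightarrow> r i \<cdot> z = r i \<cdot> (x i \<cdot> e))"
        using rel_\<theta> by blast
    qed
  qed
qed

lemma CRT_exact_arithmetical:
  assumes "CRT C 2" "CRT C 3"
  shows "exact_arithmetical_category C"
proof -
  have reflexive: "equivalence_relation C X m" "effective C X m"
    if "X \<in> Obj C" "reflexive_relation C X m" for X m
  proof -
    interpret regular_object C X
      by unfold_locales (rule that(1))
    show "equivalence_relation C X m" "effective C X m"
      using CRT2_reflexive[OF assms(1) that(2)] .
  qed
  \<comment> \<open>Equivalence relations are reflexive, so effectiveness of all reflexive relations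
    includes exactness.\<close>
  then have "exact_category C" and maltsev: "maltsev_category C"
    using regular finitely_complete
    by (auto simp: exact_category_def maltsev_category_def equivalence_relation_def)
  moreover have "distributive_lattice (Equiv C X)" if "X \<in> Obj C" for X
  proof -
    interpret maltsev_object C X
      by unfold_locales (rule that, rule maltsev)
    show ?thesis
      using CRT3_distributive[OF assms(2)] reflexive(2)[OF that]
      by (simp add: equivalence_relation_def)
  qed
  ultimately show ?thesis
    by (simp add: exact_arithmetical_category_def)
qed

end

theorem theorem5p2:
  fixes C :: "('o, 'm) cat"
  assumes "regular_category C"
  shows "(exact_arithmetical_category C \<longleftrightarrow> CRT C 2 \<and> CRT C 3) \<and>
         (CRT C 2 \<and> CRT C 3 \<longleftrightarrow> (\<forall>n\<ge>2. CRT C n))"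
proof -
  interpret regular C
    using assms by (simp add: regular_def regular_axioms_def regular_category_def finitely_complete_def)
  \<comment> \<open>The implications form a cycle: from (i) to (iii), by specialization to (ii), and
    back to (i).\<close>
  have "exact_arithmetical_category C \<Longrightarrow> \<forall>n\<ge>2. CRT C n"
    using exact_arithmetical_CRT by simp
  moreover have "\<forall>n\<ge>2. CRT C n \<Longrightarrow> CRT C 2 \<and> CRT C 3"
    by simp
  ultimately show ?thesis
    using CRT_exact_arithmetical by blast
qed

end
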